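(* Let $1<p<\infty$. Then, for any locally absolutely continuous function $u$ on $(0,\infty)$ with $\liminf_{r\to 0} |u(r)|=0$, $$ \int_0^\infty \max\left\{ \sup_{0< s\leq r} \frac{|u(s)|^p}{r^p}, \sup_{r\leq s<\infty} \frac{|u(s)|^p}{s^p} \right\} dr \leq \left(\frac{p}{p-1} \right)^p \int_0^\infty |u'(r)|^p\,dr \,. $$ *)

theory Defs
  imports "HOL-Analysis.Analysis"
begin

definition abs_cont_on_interval :: "(real \<Rightarrow> real) \<Rightarrow> real \<Rightarrow> real \<Rightarrow> bool" where
  "abs_cont_on_interval u a b \<longleftrightarrow>
     (\<forall>\<epsilon>>0. \<exists>\<delta>>0. \<forall>(n::nat) (c::nat \<Rightarrow> real) (d::nat \<Rightarrow> real).
        (\<forall>i<n. a \<le> c i \<and> c i < d i \<and> d i \<le> b) \<longrightarrow>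
        (\<forall>i<n. \<forall>j<n. i \<noteq> j \<longrightarrow> {c i<..<d i} \<inter> {c j<..<d j} = {}) \<longrightarrow>
        (\<Sum>i<n. d i - c i) < \<delta> \<longrightarrow>
        (\<Sum>i<n. \<bar>u (d i) - u (c i)\<bar>) < \<epsilon>)"

definition loc_abs_cont_pos :: "(real \<Rightarrow> real) \<Rightarrow> bool" where
  "loc_abs_cont_pos u \<longleftrightarrow> (\<forall>a b. 0 < a \<longrightarrow> a \<le> b \<longrightarrow> abs_cont_on_interval u a b)"

end

theory Submission
  imports Defs
begin

text \<open>
  Since \<open>u\<close> is locally absolutely continuous and \<open>liminf \<bar>u\<bar> = 0\<close> at the origin,
  \<open>\<bar>u s\<bar> \<le> \<integral>\<^sub>0\<^sup>s \<bar>u'\<bar>\<close>, so the integrand on the left is at most \<open>M r powr p\<close>, where \<open>M r\<close> is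
  the supremum over \<open>s \<ge> r\<close> of the mean of \<open>\<bar>u'\<bar>\<close> on \<open>(0, s)\<close>.
  The function \<open>M\<close> is nonincreasing and satisfies the weak-type bound
  \<open>l * \<bar>{M > l}\<bar> \<le> \<integral>\<^bsub>{M > l}\<^esub> \<bar>u'\<bar>\<close>. As in Doob's maximal inequality, integrating against
  \<open>p * l powr (p - 2)\<close> gives \<open>\<integral> M powr p \<le> q * \<integral> \<bar>u'\<bar> * M powr (p - 1)\<close> with
  \<open>q = p / (p - 1)\<close>, and Young's inequality then yields the sharp constant \<open>q powr p\<close>.
\<close>

section \<open>Differentiability of functions of bounded variation\<close>

text \<open>Since \<open>deriv u\<close> is the pointwise derivative, the bound on \<open>u\<close>
  needs two facts: absolute continuity gives differentiability almost everywhere, and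
  \<open>u\<close> is recovered from \<open>deriv u\<close> by integration. Both are obtained from
  finite families of intervals. Locally \<open>u\<close> has bounded variation, so Vitali coverings
  show that the points with unbounded or oscillating difference quotients form a null set; a gauge
  argument then gives the fundamental theorem. In the maximal inequality the obstacle is
  circularity: Young's inequality returns a multiple of the integral of \<open>M powr p\<close>,
  which can be subtracted only if that integral is finite. Hence the estimate is proved for bounded
  functions vanishing far out, and truncation with monotone convergence gives the general case. The
  integral of \<open>\<bar>u'\<bar>\<close> near the origin may also be infinite, so the general
  inequality compares \<open>y * t\<close> with an integral over \<open>(0, t)\<close> instead of
  forming a quotient.\<close>

definition increment :: "(real \<Rightarrow> real) \<Rightarrow> real set \<Rightarrow> real" where
  "increment u K = u (Sup K) - u (Inf K)"

lemma increment_Icc [simp]: "s \<le> t \<Longrightarrow> increment u {s..t} = u t - u s"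
  by (simp add: increment_def)

lemma increment_singleton [simp]: "increment u {s} = 0"
  by (simp add: increment_def)

lemma division_of_member_real:
  assumes "D division_of S" "K \<in> D"
  shows "\<exists>k l::real. k \<le> l \<and> K = {k..l}"
  using division_ofD(3,4)[OF assms] by (metis atLeastatMost_empty_iff2 box_real(2))

lemma sum_increment_division:
  assumes "D division_of {a..b}" "a \<le> b"
  shows "(\<Sum>K\<in>D. increment u K) = u b - u a"
proof -
  note D = division_ofD[OF assms(1)]
  \<comment> \<open>Tagging each interval by its left endpoint is injective, so telescoping over
    tagged divisions transfers to untagged ones.\<close>
  let ?p = "(\<lambda>K. (Inf K, K)) ` D"
  have Inf_in: "Inf K \<in> K" if "K \<in> D" for K
    using D(3,4)[OF that] by auto
  have "?p tagged_division_of {a..b}"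
  proof (rule tagged_division_ofI)
    have "{K. \<exists>x. (x, K) \<in> ?p} = D" by auto
    then show "\<Union>{K. \<exists>x. (x, K) \<in> ?p} = {a..b}" using D(6) by simp
    fix x1 K1 x2 K2 assume "(x1, K1) \<in> ?p" "(x2, K2) \<in> ?p" "(x1, K1) \<noteq> (x2, K2)"
    then have "K1 \<in> D" "K2 \<in> D" "K1 \<noteq> K2" by auto
    then show "interior K1 \<inter> interior K2 = {}" by (rule D(5))
  qed (use D(1,2,4) Inf_in in auto)
  then have "(\<Sum>(x, K)\<in>?p. increment u K) = u b - u a"
    using additive_tagged_division_1[OF assms(2)] by (simp add: increment_def)
  moreover have "(\<Sum>(x, K)\<in>?p. increment u K) = (\<Sum>K\<in>D. increment u K)"
    by (subst sum.reindex) (auto simp: inj_on_def)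
  ultimately show ?thesis by simp
qed

text \<open>\<open>D division_of \<Union>D\<close> says only that \<open>D\<close> is a finite
  family of nonoverlapping compact intervals. This form of absolute continuity can be combined with
  coverings and tagged divisions.\<close>

lemma abs_cont_on_interval_division:
  assumes "abs_cont_on_interval u a b" "e > 0"
  obtains d where "d > 0"
    "\<And>D. D division_of \<Union>D \<Longrightarrow> \<Union>D \<subseteq> {a..b} \<Longrightarrow> sum (measure lborel) D < d \<Longrightarrow> (\<Sum>K\<in>D. \<bar>increment u K\<bar>) < e"
proof -
  from assms obtain d where "d > 0" and d: "\<forall>(n::nat) (c::nat \<Rightarrow> real) (d'::nat \<Rightarrow> real).
        (\<forall>i<n. a \<le> c i \<and> c i < d' i \<and> d' i \<le> b) \<longrightarrow>
        (\<forall>i<n. \<forall>j<n. i \<noteq> j \<longrightarrow> {c i<..<d' i} \<inter> {c j<..<d' j} = {}) \<longrightarrow>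
        (\<Sum>i<n. d' i - c i) < d \<longrightarrow>
        (\<Sum>i<n. \<bar>u (d' i) - u (c i)\<bar>) < e"
    unfolding abs_cont_on_interval_def by blast
  show ?thesis
  proof
    show "d > 0" by fact
    fix D assume D: "D division_of \<Union>D" and sub: "\<Union>D \<subseteq> {a..b}" and small: "sum (measure lborel) D < d"
    note DD = division_ofD[OF D]
    \<comment> \<open>The definition asks for \<open>c i < d i\<close>; degenerate intervals are set
      aside, and their increment is zero.\<close>
    define D' where "D' = {K\<in>D. Inf K < Sup K}"
    have Icc: "K = {Inf K..Sup K}" "Inf K \<le> Sup K" if "K \<in> D" for K
      using DD(3,4)[OF that] by auto
    have fin: "finite D'" unfolding D'_def using DD(1) by auto
    then obtain h where h: "bij_betw h {..<card D'} D'"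
      using ex_bij_betw_nat_finite[OF fin] by (auto simp: atLeast0LessThan)
    have hin: "h i \<in> D'" if "i < card D'" for i
      using h that by (auto simp: bij_betw_def)
    have hinj: "h i \<noteq> h j" if "i < card D'" "j < card D'" "i \<noteq> j" for i j
      using h that by (auto simp: bij_betw_def inj_on_def)
    have int: "interior K = {Inf K<..<Sup K}" if "K \<in> D" for K
      using Icc[OF that] by (metis interior_atLeastAtMost_real)
    have len: "measure lborel K = Sup K - Inf K" if "K \<in> D" for K
      using Icc[OF that] by (metis content_real)
    have "(\<Sum>i<card D'. \<bar>u (Sup (h i)) - u (Inf (h i))\<bar>) < e"
    proof (rule d[THEN spec, THEN spec, THEN spec, THEN mp, THEN mp, THEN mp])
      show "\<forall>i<card D'. a \<le> Inf (h i) \<and> Inf (h i) < Sup (h i) \<and> Sup (h i) \<le> b"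
      proof (intro allI impI)
        fix i assume "i < card D'"
        then have "h i \<in> D" "Inf (h i) < Sup (h i)" using hin by (auto simp: D'_def)
        moreover from this have "Inf (h i) \<in> h i" "Sup (h i) \<in> h i"
          using Icc[of "h i"] by (metis atLeastAtMost_iff order_refl)+
        ultimately show "a \<le> Inf (h i) \<and> Inf (h i) < Sup (h i) \<and> Sup (h i) \<le> b"
          using sub by fastforce
      qed
      show "\<forall>i<card D'. \<forall>j<card D'. i \<noteq> j \<longrightarrow>
          {Inf (h i)<..<Sup (h i)} \<inter> {Inf (h j)<..<Sup (h j)} = {}"
        using DD(5) hin hinj int unfolding D'_def by (metis (no_types, lifting) mem_Collect_eq)
      have "(\<Sum>i<card D'. Sup (h i) - Inf (h i)) = (\<Sum>K\<in>D'. Sup K - Inf K)"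
        by (rule sum.reindex_bij_betw[OF h])
      also have "\<dots> = sum (measure lborel) D'"
        by (rule sum.cong) (auto simp: len D'_def)
      also have "\<dots> \<le> sum (measure lborel) D"
        by (rule sum_mono2) (use DD(1) in \<open>auto simp: D'_def\<close>)
      finally show "(\<Sum>i<card D'. Sup (h i) - Inf (h i)) < d" using small by simp
    qed
    also have "(\<Sum>i<card D'. \<bar>u (Sup (h i)) - u (Inf (h i))\<bar>) = (\<Sum>K\<in>D'. \<bar>increment u K\<bar>)"
      unfolding increment_def by (rule sum.reindex_bij_betw[OF h])
    also have "\<dots> = (\<Sum>K\<in>D. \<bar>increment u K\<bar>)"
    proof (rule sum.mono_neutral_left)
      show "\<forall>K\<in>D - D'. \<bar>increment u K\<bar> = 0"
        using Icc(2) unfolding D'_def increment_def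
        by (metis (no_types, lifting) DiffE abs_0 diff_self mem_Collect_eq order_le_imp_less_or_eq)
    qed (use DD(1) in \<open>auto simp: D'_def\<close>)
    finally show "(\<Sum>K\<in>D. \<bar>increment u K\<bar>) < e" .
  qed
qed

text \<open>Vitali's theorem extracts a countable disjoint subfamily covering \<open>E - N\<close>
  up to a null set; its finite subfamilies have total length at most \<open>e\<close>, so its union
  has measure at most \<open>e\<close>. The set \<open>N\<close>, which may depend on
  \<open>e\<close>, leaves room for points the family misses, such as endpoints of a
  division.\<close>

lemma negligible_Vitali_intervals:
  fixes E :: "real set"
  assumes "\<And>e. e > 0 \<Longrightarrow> \<exists>N \<I>. negligible N \<and> (\<forall>K\<in>\<I>. \<exists>s t. s < t \<and> K = {s..t}) \<and>
     (\<forall>x\<in>E - N. \<forall>d>0. \<exists>K\<in>\<I>. x \<in> K \<and> measure lborel K < d) \<and>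
     (\<forall>\<F>. finite \<F> \<longrightarrow> \<F> \<subseteq> \<I> \<longrightarrow> pairwise disjnt \<F> \<longrightarrow> sum (measure lborel) \<F> \<le> e)"
  shows "negligible E"
  unfolding negligible_outer_le
proof (intro allI impI)
  fix e :: real assume "e > 0"
  from assms[OF this] obtain N \<I> where N: "negligible N"
    and Icc: "\<And>K. K \<in> \<I> \<Longrightarrow> \<exists>s t. s < t \<and> K = {s..t}"
    and cov: "\<And>x d. x \<in> E - N \<Longrightarrow> d > 0 \<Longrightarrow> \<exists>K\<in>\<I>. x \<in> K \<and> measure lborel K < d"
    and small: "\<And>\<F>. finite \<F> \<Longrightarrow> \<F> \<subseteq> \<I> \<Longrightarrow> pairwise disjnt \<F> \<Longrightarrow> sum (measure lborel) \<F> \<le> e"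
    by metis
  \<comment> \<open>The covering theorem speaks of balls, so each interval is read as the closed
    ball about its midpoint.\<close>
  let ?m = "\<lambda>K::real set. (Inf K + Sup K) / 2" and ?r = "\<lambda>K::real set. (Sup K - Inf K) / 2"
  have ball: "cball (?m K) (?r K) = K" "?r K > 0" "?r K \<le> measure lborel K" if "K \<in> \<I>" for K
    using Icc[OF that] by (auto simp: cball_eq_atLeastAtMost field_simps)
  obtain C where C: "countable C" "C \<subseteq> \<I>"
     "pairwise (\<lambda>i j. disjnt (cball (?m i) (?r i)) (cball (?m j) (?r j))) C"
     "negligible ((E - N) - (\<Union>i \<in> C. cball (?m i) (?r i)))"
  proof (rule Vitali_covering_theorem_cballs[of \<I> ?r "E - N" ?m])
    show "\<exists>i. i \<in> \<I> \<and> x \<in> cball (?m i) (?r i) \<and> ?r i < d" if x: "x \<in> E - N" "0 < d" for x d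
      using cov[OF x] ball by (metis le_less_trans)
  qed (use ball in auto)
  have UC: "(\<Union>i \<in> C. cball (?m i) (?r i)) = \<Union>C"
    using C(2) ball(1) by auto
  have disj: "pairwise disjnt C"
    using C(2,3) ball(1) unfolding pairwise_def by (metis subsetD)
  have meas: "K \<in> lmeasurable" if "K \<in> C" for K
    using Icc C(2) that by (metis lmeasurable_interval(1) subsetD box_real(2) lmeasurable_cbox)
  have bound: "measure lebesgue (\<Union>\<F>) \<le> e" if F: "\<F> \<subseteq> C" "finite \<F>" for \<F>
  proof -
    have "measure lebesgue (\<Union>\<F>) \<le> (\<Sum>K\<in>\<F>. measure lebesgue K)"
      by (rule measure_Union_le) (use F meas in \<open>auto simp: fmeasurableD\<close>)
    also have "\<dots> = sum (measure lborel) \<F>"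
      by (rule sum.cong) (use F C(2) Icc in \<open>force+\<close>)
    also have "\<dots> \<le> e"
      by (rule small) (use F C(2) disj in \<open>auto intro: pairwise_subset\<close>)
    finally show ?thesis .
  qed
  let ?T = "\<Union>C \<union> (N \<union> ((E - N) - \<Union>C))"
  have neg: "negligible (N \<union> ((E - N) - \<Union>C))"
    using C(4) N unfolding UC by auto
  have mC: "\<Union>C \<in> lmeasurable" "measure lebesgue (\<Union>C) \<le> e"
    using fmeasurable_Union_bound[OF C(1) meas bound] measure_Union_bound[OF C(1) meas bound] by auto
  have "?T \<in> lmeasurable" "measure lebesgue ?T \<le> e"
    using mC neg by (auto simp: measure_Un_null_set negligible_iff_null_sets
        negligible_imp_measurable fmeasurable.Un intro: fmeasurableD)
  then show "\<exists>T. E \<subseteq> T \<and> T \<in> lmeasurable \<and> measure lebesgue T \<le> e"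
    by (intro exI[of _ ?T]) auto
qed

definition bounded_variation_by :: "real \<Rightarrow> (real \<Rightarrow> real) \<Rightarrow> real \<Rightarrow> real \<Rightarrow> bool" where
  "bounded_variation_by B u a b \<longleftrightarrow>
     (\<forall>D. D division_of \<Union>D \<longrightarrow> \<Union>D \<subseteq> {a..b} \<longrightarrow> (\<Sum>K\<in>D. \<bar>increment u K\<bar>) \<le> B)"

lemma disjoint_intervals_division:
  fixes \<F> :: "real set set"
  assumes "finite \<F>" "pairwise disjnt \<F>" "\<And>K. K \<in> \<F> \<Longrightarrow> \<exists>s t. s < t \<and> K = {s..t}"
  shows "\<F> division_of \<Union>\<F>"
proof (rule division_ofI)
  fix K assume "K \<in> \<F>"
  then obtain s t where "s < t" "K = {s..t}" using assms(3) by blast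
  then show "K \<noteq> {}" "\<exists>a b. K = cbox a b" by auto
next
  fix K1 K2 assume "K1 \<in> \<F>" "K2 \<in> \<F>" "K1 \<noteq> K2"
  then have "K1 \<inter> K2 = {}" using assms(2) by (auto simp: pairwise_def disjnt_def)
  then show "interior K1 \<inter> interior K2 = {}" using interior_subset by blast
qed (use assms in auto)

text \<open>Disjoint intervals on which the slope exceeds \<open>k > 0\<close> in absolute value
  have total length at most \<open>B / k\<close>, and \<open>k\<close> can be taken arbitrarily
  large.\<close>

lemma bounded_variation_steep_negligible:
  assumes bv: "bounded_variation_by B u a b"
    and E: "E \<subseteq> {a<..<b}"
    and steep: "\<And>x k d. x \<in> E \<Longrightarrow> d > 0 \<Longrightarrow> \<exists>s t. s < t \<and> x \<in> {s..t} \<and> t - s < d \<and> \<bar>u t - u s\<bar> > k * (t - s)"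
  shows "negligible E"
proof (rule negligible_Vitali_intervals)
  fix e :: real assume "e > 0"
  \<comment> \<open>Chosen so that \<open>k * e = \<bar>B\<bar> + 1\<close> dominates
    \<open>B\<close>; the \<open>1\<close> keeps \<open>k\<close> positive when
    \<open>B = 0\<close>.\<close>
  define k where "k = (\<bar>B\<bar> + 1) / e"
  have "k > 0" using \<open>e > 0\<close> by (simp add: k_def add_nonneg_pos)
  let ?I = "{{s..t} | s t. s < t \<and> {s..t} \<subseteq> {a..b} \<and> \<bar>u t - u s\<bar> > k * (t - s)}"
  have "\<exists>K\<in>?I. x \<in> K \<and> measure lborel K < d" if x: "x \<in> E" "d > 0" for x d
  proof -
    have "min d (min (x - a) (b - x)) > 0" using x E by auto
    from steep[OF x(1) this, of k] obtain s t where st: "s < t" "x \<in> {s..t}"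
      "t - s < min d (min (x - a) (b - x))" "\<bar>u t - u s\<bar> > k * (t - s)" by blast
    then have "{s..t} \<in> ?I" by auto
    then show ?thesis using st by (intro bexI[of _ "{s..t}"]) auto
  qed
  moreover have "sum (measure lborel) \<F> \<le> e"
    if F: "finite \<F>" "\<F> \<subseteq> ?I" "pairwise disjnt \<F>" for \<F>
  proof -
    have "\<F> division_of \<Union>\<F>"
      by (rule disjoint_intervals_division) (use F in auto)
    moreover have "\<Union>\<F> \<subseteq> {a..b}" using F by auto
    ultimately have "(\<Sum>K\<in>\<F>. \<bar>increment u K\<bar>) \<le> B"
      using bv unfolding bounded_variation_by_def by blast
    moreover have "(\<Sum>K\<in>\<F>. k * measure lborel K) \<le> (\<Sum>K\<in>\<F>. \<bar>increment u K\<bar>)"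
    proof (rule sum_mono)
      fix K assume "K \<in> \<F>"
      then obtain s t where "K = {s..t}" "s < t" "\<bar>u t - u s\<bar> > k * (t - s)" using F by blast
      then show "k * measure lborel K \<le> \<bar>increment u K\<bar>" by simp
    qed
    ultimately have "k * sum (measure lborel) \<F> \<le> k * e"
      using \<open>e > 0\<close> by (simp add: sum_distrib_left k_def)
    then show ?thesis using \<open>k > 0\<close> by simp
  qed
  ultimately show "\<exists>N \<I>. negligible N \<and> (\<forall>K\<in>\<I>. \<exists>s t. s < t \<and> K = {s..t}) \<and>
     (\<forall>x\<in>E - N. \<forall>d>0. \<exists>K\<in>\<I>. x \<in> K \<and> measure lborel K < d) \<and>
     (\<forall>\<F>. finite \<F> \<longrightarrow> \<F> \<subseteq> \<I> \<longrightarrow> pairwise disjnt \<F> \<longrightarrow> sum (measure lborel) \<F> \<le> e)"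
    by (intro exI[of _ "{}"] exI[of _ ?I]) auto
qed

text \<open>With \<open>\<sigma>\<close> the sign of the total increment, its absolute value is the
  sum of \<open>\<sigma>\<close> times the increments over \<open>q\<close>. A member of
  \<open>F\<close> runs against that sign, so passing to absolute values gains twice its absolute
  increment.\<close>

lemma sum_abs_increment_ge:
  assumes q: "q division_of {k..l}" "k \<le> l" and F: "F \<subseteq> q"
    and steep: "\<And>J. J \<in> F \<Longrightarrow> if u k \<le> u l then increment u J \<le> - c * measure lborel J else c * measure lborel J \<le> increment u J"
    and "c > 0"
  shows "\<bar>increment u {k..l}\<bar> + 2 * c * sum (measure lborel) F \<le> (\<Sum>J\<in>q. \<bar>increment u J\<bar>)"
proof -
  define \<sigma> :: real where "\<sigma> = (if u k \<le> u l then 1 else -1)"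
  have fin: "finite q" using q by auto
  have "\<bar>increment u {k..l}\<bar> = \<sigma> * (u l - u k)"
    using q(2) by (simp add: \<sigma>_def)
  also have "\<dots> = (\<Sum>J\<in>q. \<sigma> * increment u J)"
    by (simp add: sum_increment_division[OF q] flip: sum_distrib_left)
  also have "\<dots> \<le> (\<Sum>J\<in>q. \<bar>increment u J\<bar> - (if J \<in> F then 2 * c * measure lborel J else 0))"
  proof (rule sum_mono)
    fix J assume "J \<in> q"
    show "\<sigma> * increment u J \<le> \<bar>increment u J\<bar> - (if J \<in> F then 2 * c * measure lborel J else 0)"
    proof (cases "J \<in> F")
      case True
      have "0 \<le> c * measure lborel J" using \<open>c > 0\<close> by simp
      with steep[OF True] True show ?thesis by (simp add: \<sigma>_def split: if_splits)
    qed (auto simp: \<sigma>_def)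
  qed
  also have "\<dots> = (\<Sum>J\<in>q. \<bar>increment u J\<bar>) - 2 * c * sum (measure lborel) F"
    using F fin by (simp add: sum_subtractf sum_distrib_left sum.If_cases Int_absorb1)
  finally show ?thesis by simp
qed

text \<open>Botsko's argument: refining a division of almost maximal variation by intervals on which
  \<open>u\<close> moves against the sign of its increment would increase the variation too much.\<close>

lemma bounded_variation_oscillation_negligible:
  assumes bv: "bounded_variation_by B u a b" and "c > 0"
    and E: "E \<subseteq> {a<..<b}"
    and up: "\<And>x d. x \<in> E \<Longrightarrow> d > 0 \<Longrightarrow> \<exists>s t. s < t \<and> x \<in> {s..t} \<and> t - s < d \<and> u t - u s > c * (t - s)"
    and down: "\<And>x d. x \<in> E \<Longrightarrow> d > 0 \<Longrightarrow> \<exists>s t. s < t \<and> x \<in> {s..t} \<and> t - s < d \<and> u t - u s < - c * (t - s)"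
  shows "negligible E"
proof (rule negligible_Vitali_intervals)
  fix e :: real assume "e > 0"
  define \<V> where "\<V> = {D. D division_of \<Union>D \<and> \<Union>D \<subseteq> {a..b}}"
  define S where "S = (\<lambda>D. \<Sum>K\<in>D. \<bar>increment u K\<bar>)"
  have bdd: "bdd_above (S ` \<V>)" and ne: "\<V> \<noteq> {}"
    using bv unfolding bounded_variation_by_def \<V>_def S_def
    by (auto intro!: bdd_aboveI2[of _ _ B] exI[of _ "{}"])
  define V where "V = (SUP D\<in>\<V>. S D)"
  \<comment> \<open>By \<open>sum_abs_increment_ge\<close>, inserting a suitable disjoint family of
    total length \<open>L\<close> raises the sum by at least \<open>2 * c * L\<close>; starting
    within \<open>2 * c * e\<close> of the supremum therefore forces
    \<open>L \<le> e\<close>.\<close>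
  have "V - 2 * c * e < V" using \<open>c > 0\<close> \<open>e > 0\<close> by simp
  then obtain D0 where D0: "D0 \<in> \<V>" "V - 2 * c * e < S D0"
    unfolding V_def less_cSUP_iff[OF ne bdd] by blast
  show "\<exists>N \<I>. negligible N \<and> (\<forall>K\<in>\<I>. \<exists>s t. s < t \<and> K = {s..t}) \<and>
     (\<forall>x\<in>E - N. \<forall>d>0. \<exists>K\<in>\<I>. x \<in> K \<and> measure lborel K < d) \<and>
     (\<forall>\<F>. finite \<F> \<longrightarrow> \<F> \<subseteq> \<I> \<longrightarrow> pairwise disjnt \<F> \<longrightarrow> sum (measure lborel) \<F> \<le> e)"
  proof (cases "a \<le> b")
    case False
    then have "E = {}" using E by auto
    then show ?thesis by (intro exI[of _ "{}"]) (use \<open>e > 0\<close> in auto)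
  next
    case True
    \<comment> \<open>Completing \<open>D0\<close> to fill \<open>{a..b}\<close> does not lower the
      sum and places every point of \<open>E\<close> in some member.\<close>
    have "{{a..b}} division_of {a..b}"
      using division_of_self[of a b] True by simp
    then obtain D where D: "D0 \<subseteq> D" "D division_of {a..b}"
      using partial_division_extend[of D0 "\<Union>D0" "{{a..b}}" "{a..b}"] D0 unfolding \<V>_def by blast
    note DD = division_ofD[OF D(2)]
    have SD: "V - 2 * c * e < S D"
      using D0(2) sum_mono2[OF DD(1) D(1), of "\<lambda>K. \<bar>increment u K\<bar>"] unfolding S_def by simp
    have Icc: "\<exists>k l. k \<le> l \<and> K = {k..l}" if "K \<in> D" for K
      using division_of_member_real[OF D(2) that] .
    \<comment> \<open>With the endpoints removed, each remaining point is interior to its member of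
      \<open>D\<close>, whose increment fixes the sign to be opposed.\<close>
    define N where "N = (\<Union>K\<in>D. {Inf K, Sup K})"
    have "finite N" using DD(1) by (simp add: N_def)
    define \<I> where "\<I> = {{s..t} | s t. s < t \<and> (\<exists>K\<in>D. {s..t} \<subseteq> interior K \<and>
       (if 0 \<le> increment u K then u t - u s \<le> - c * (t - s) else c * (t - s) \<le> u t - u s))}"
    have cover: "\<exists>J\<in>\<I>. x \<in> J \<and> measure lborel J < d" if x: "x \<in> E - N" "d > 0" for x d
    proof -
      have "x \<in> \<Union>D" using x E DD(6) by auto
      then obtain K where K: "K \<in> D" "x \<in> K" by blast
      from Icc[OF K(1)] obtain k l where kl: "k \<le> l" "K = {k..l}" by blast
      have "x \<noteq> k" "x \<noteq> l" using x K(1) kl by (auto simp: N_def)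
      then have pos: "min d (min (x - k) (l - x)) > 0" using K(2) kl x by auto
      obtain s t where st: "s < t" "x \<in> {s..t}" "t - s < min d (min (x - k) (l - x))"
        "if 0 \<le> increment u K then u t - u s \<le> - c * (t - s) else c * (t - s) \<le> u t - u s"
      proof (cases "0 \<le> increment u K")
        case True
        from down[OF _ pos, of x] x(1) obtain s t where "s < t" "x \<in> {s..t}"
          "t - s < min d (min (x - k) (l - x))" "u t - u s < - c * (t - s)" by blast
        with True show ?thesis by (intro that[of s t]) auto
      next
        case False
        from up[OF _ pos, of x] x(1) obtain s t where "s < t" "x \<in> {s..t}"
          "t - s < min d (min (x - k) (l - x))" "u t - u s > c * (t - s)" by blast
        with False show ?thesis by (intro that[of s t]) auto
      qed
      have "{s..t} \<subseteq> interior K" using st kl by auto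
      then have "{s..t} \<in> \<I>" unfolding \<I>_def using st K(1) by blast
      then show ?thesis using st by (intro bexI[of _ "{s..t}"]) auto
    qed
    have small: "sum (measure lborel) \<F> \<le> e"
      if F: "finite \<F>" "\<F> \<subseteq> \<I>" "pairwise disjnt \<F>" for \<F>
    proof -
      have FIcc: "\<exists>s t. s < t \<and> J = {s..t}" if "J \<in> \<F>" for J
        using F(2) that unfolding \<I>_def by blast
      define G where "G K = {J\<in>\<F>. J \<subseteq> interior K}" for K
      have steep: "if 0 \<le> increment u K then increment u J \<le> - c * measure lborel J
          else c * measure lborel J \<le> increment u J" if J: "J \<in> G K" and K: "K \<in> D" for J K
      proof -
        from J F(2) obtain s t K' where st: "J = {s..t}" "s < t" "K' \<in> D" "{s..t} \<subseteq> interior K'"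
          "if 0 \<le> increment u K' then u t - u s \<le> - c * (t - s) else c * (t - s) \<le> u t - u s"
          unfolding G_def \<I>_def by blast
        have "s \<in> interior K \<inter> interior K'" using st J by (auto simp: G_def)
        then have "K' = K" using DD(5) K st(3) by blast
        then show ?thesis using st by (simp split: if_splits)
      qed
      have "\<exists>q. q division_of K \<and> G K \<subseteq> q" if K: "K \<in> D" for K
      proof -
        from Icc[OF K] obtain k l where kl: "k \<le> l" "K = {k..l}" by blast
        have "G K division_of \<Union>(G K)"
          by (rule disjoint_intervals_division)
             (use F FIcc in \<open>auto simp: G_def intro: pairwise_subset\<close>)
        moreover have "{K} division_of K" using division_of_self[of k l] kl by simp
        moreover have "\<Union>(G K) \<subseteq> K" using interior_subset by (auto simp: G_def)
        ultimately show ?thesis using partial_division_extend by metis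
      qed
      then obtain q where q: "\<And>K. K \<in> D \<Longrightarrow> q K division_of K" "\<And>K. K \<in> D \<Longrightarrow> G K \<subseteq> q K"
        by metis
      define r where "r K = {J\<in>q K. interior J \<noteq> {}}" for K
      have sum_r: "(\<Sum>J\<in>r K. \<bar>increment u J\<bar>) = (\<Sum>J\<in>q K. \<bar>increment u J\<bar>)" if K: "K \<in> D" for K
      proof (rule sum.mono_neutral_left)
        show "\<forall>J\<in>q K - r K. \<bar>increment u J\<bar> = 0"
        proof
          fix J assume J: "J \<in> q K - r K"
          then obtain k l where "J = {k..l}" "k \<le> l"
            using division_of_member_real[OF q(1)[OF K]] by blast
          moreover from this have "k = l" using J by (auto simp: r_def)
          ultimately show "\<bar>increment u J\<bar> = 0" by simp
        qed
      qed (use division_ofD(1)[OF q(1)[OF K]] in \<open>auto simp: r_def\<close>)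
      have r_int: "interior J \<subseteq> interior K" "interior J \<noteq> {}" if "J \<in> r K" "K \<in> D" for J K
        using that division_ofD(2)[OF q(1)] unfolding r_def by (auto intro!: interior_mono)
      have r_fin: "finite (r K)" if "K \<in> D" for K
        using division_ofD(1)[OF q(1)[OF that]] by (simp add: r_def)
      let ?R = "\<Union>K\<in>D. r K"
      have "?R division_of \<Union>?R"
      proof (rule division_ofI)
        fix J1 J2 assume "J1 \<in> ?R" "J2 \<in> ?R" and ne: "J1 \<noteq> J2"
        then obtain K1 K2 where K: "K1 \<in> D" "K2 \<in> D" "J1 \<in> r K1" "J2 \<in> r K2" by blast
        show "interior J1 \<inter> interior J2 = {}"
        proof (cases "K1 = K2")
          case True
          then show ?thesis using division_ofD(5)[OF q(1)[OF K(1)]] K ne by (auto simp: r_def)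
        next
          case False
          then show ?thesis using DD(5)[OF K(1,2)] r_int(1)[OF K(3,1)] r_int(1)[OF K(4,2)] by blast
        qed
      next
        fix J assume "J \<in> ?R"
        then show "J \<noteq> {}" "\<exists>a b. J = cbox a b"
          using division_ofD(3,4)[OF q(1)] by (auto simp: r_def)
      qed (use DD(1) r_fin in auto)
      moreover have "\<Union>?R \<subseteq> {a..b}"
        using division_ofD(2)[OF q(1)] DD(2) unfolding r_def by blast
      ultimately have "S ?R \<le> V"
        unfolding V_def by (intro cSUP_upper bdd) (simp add: \<V>_def)
      have "S D + 2 * c * sum (measure lborel) \<F> = (\<Sum>K\<in>D. \<bar>increment u K\<bar> + 2 * c * sum (measure lborel) (G K))"
      proof -
        have "\<F> = (\<Union>K\<in>D. G K)"
          using F(2) unfolding G_def \<I>_def by auto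
        then have "sum (measure lborel) \<F> = sum (measure lborel) (\<Union>K\<in>D. G K)"
          by simp
        also have "\<dots> = (\<Sum>K\<in>D. sum (measure lborel) (G K))"
        proof (rule sum.UNION_disjoint)
          show "\<forall>K\<in>D. \<forall>K'\<in>D. K \<noteq> K' \<longrightarrow> G K \<inter> G K' = {}"
          proof (intro ballI impI, rule ccontr)
            fix K K' assume K: "K \<in> D" "K' \<in> D" "K \<noteq> K'" and "G K \<inter> G K' \<noteq> {}"
            then obtain J where J: "J \<in> \<F>" "J \<subseteq> interior K \<inter> interior K'" by (auto simp: G_def)
            moreover have "J \<noteq> {}" using FIcc[OF J(1)] by auto
            ultimately show False using DD(5)[OF K] by auto
          qed
        qed (use DD(1) F(1) in \<open>auto simp: G_def\<close>)
        finally show ?thesis by (simp add: S_def sum.distrib sum_distrib_left)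
      qed
      also have "\<dots> \<le> (\<Sum>K\<in>D. \<Sum>J\<in>q K. \<bar>increment u J\<bar>)"
      proof (rule sum_mono)
        fix K assume K: "K \<in> D"
        from Icc[OF K] obtain k l where kl: "k \<le> l" "K = {k..l}" by blast
        show "\<bar>increment u K\<bar> + 2 * c * sum (measure lborel) (G K) \<le> (\<Sum>J\<in>q K. \<bar>increment u J\<bar>)"
          unfolding kl(2)
        proof (rule sum_abs_increment_ge)
          show "if u k \<le> u l then increment u J \<le> - c * measure lborel J
              else c * measure lborel J \<le> increment u J" if "J \<in> G {k..l}" for J
            using steep[of J K] that K kl by simp
        qed (use q[OF K] kl \<open>c > 0\<close> in auto)
      qed
      also have "\<dots> = (\<Sum>K\<in>D. \<Sum>J\<in>r K. \<bar>increment u J\<bar>)"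
        by (rule sum.cong[OF refl]) (simp add: sum_r)
      also have "\<dots> = S ?R"
        unfolding S_def
      proof (rule sum.UNION_disjoint[symmetric])
        show "\<forall>K\<in>D. \<forall>K'\<in>D. K \<noteq> K' \<longrightarrow> r K \<inter> r K' = {}"
        proof (intro ballI impI, rule ccontr)
          fix K K' assume K: "K \<in> D" "K' \<in> D" "K \<noteq> K'" and "r K \<inter> r K' \<noteq> {}"
          then obtain J where "J \<in> r K" "J \<in> r K'" by blast
          then show False using DD(5)[OF K] r_int K(1,2) by blast
        qed
      qed (use DD(1) r_fin in auto)
      also note \<open>S ?R \<le> V\<close>
      finally have "2 * c * sum (measure lborel) \<F> \<le> 2 * c * e" using SD by simp
      then show ?thesis using \<open>c > 0\<close> by simp
    qed
    show ?thesis
    proof (intro exI[of _ N] exI[of _ \<I>] conjI ballI allI impI)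
      show "negligible N" by (rule negligible_finite) fact
      show "\<exists>s t. s < t \<and> K = {s..t}" if "K \<in> \<I>" for K
        using that by (auto simp: \<I>_def)
    qed (auto intro: cover small)
  qed
qed

text \<open>Passing to interiors makes the intervals disjoint without changing their lengths, so
  measure is additive over them.\<close>

lemma sum_measure_division_le:
  fixes D :: "real set set"
  assumes D: "D division_of S" and "S \<subseteq> U" "U \<in> lmeasurable"
  shows "sum (measure lborel) D \<le> measure lebesgue U"
proof -
  note DD = division_ofD[OF D]
  have "measure lborel K = measure lebesgue (interior K)" if K: "K \<in> D" for K
    using division_of_member_real[OF D K] by auto
  then have "sum (measure lborel) D = (\<Sum>K\<in>D. measure lebesgue (interior K))"
    by (rule sum.cong[OF refl])
  also have "\<dots> = measure lebesgue (\<Union>K\<in>D. interior K)"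
  proof (rule measure_UNION'[symmetric])
    show "interior K \<in> lmeasurable" if "K \<in> D" for K
      using division_of_member_real[OF D that] by auto
    show "pairwise (\<lambda>K L. disjnt (interior K) (interior L)) D"
      using DD(5) by (auto simp: pairwise_def disjnt_def)
  qed (rule DD(1))
  also have "\<dots> \<le> measure lebesgue U"
  proof (rule measure_mono_fmeasurable)
    show "(\<Union>K\<in>D. interior K) \<subseteq> U" using DD(2) assms(2) interior_subset by blast
    show "(\<Union>K\<in>D. interior K) \<in> sets lebesgue"
      by (rule sets_completionI_sets) (auto intro!: borel_open)
  qed fact
  finally show ?thesis .
qed

text \<open>Subtracting the mean of two slopes makes an oscillation between them symmetric about
  zero, as \<open>bounded_variation_oscillation_negligible\<close> requires.\<close>

lemma bounded_variation_by_diff_linear: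
  assumes "bounded_variation_by B u a b" "a \<le> b"
  shows "bounded_variation_by (B + \<bar>m\<bar> * (b - a)) (\<lambda>x. u x - m * x) a b"
  unfolding bounded_variation_by_def
proof (intro allI impI)
  fix D assume D: "D division_of \<Union>D" "\<Union>D \<subseteq> {a..b}"
  have "(\<Sum>K\<in>D. \<bar>increment (\<lambda>x. u x - m * x) K\<bar>) \<le> (\<Sum>K\<in>D. \<bar>increment u K\<bar> + \<bar>m\<bar> * measure lborel K)"
  proof (rule sum_mono)
    fix K assume "K \<in> D"
    then obtain k l where kl: "k \<le> l" "K = {k..l}" using division_of_member_real[OF D(1)] by blast
    have "\<bar>(u l - m * l) - (u k - m * k)\<bar> \<le> \<bar>u l - u k\<bar> + \<bar>m * (l - k)\<bar>"
      by (simp add: algebra_simps)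
    then show "\<bar>increment (\<lambda>x. u x - m * x) K\<bar> \<le> \<bar>increment u K\<bar> + \<bar>m\<bar> * measure lborel K"
      using kl by (simp add: abs_mult)
  qed
  also have "\<dots> \<le> B + \<bar>m\<bar> * (b - a)"
  proof -
    have "sum (measure lborel) D \<le> b - a"
      using subadditive_content_division[OF D(1), of a b] D(2) assms(2) by simp
    then show ?thesis
      using assms(1) D unfolding bounded_variation_by_def sum.distrib sum_distrib_left[symmetric]
      by (intro add_mono mult_left_mono) auto
  qed
  finally show "(\<Sum>K\<in>D. \<bar>increment (\<lambda>x. u x - m * x) K\<bar>) \<le> B + \<bar>m\<bar> * (b - a)" .
qed

section \<open>Difference quotients and differentiability almost everywhere\<close>

lemma difference_quotient_interval:
  fixes u :: "real \<Rightarrow> real"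
  assumes "\<exists>\<^sub>F y in at x. P ((u y - u x) / (y - x))" "d > 0"
  shows "\<exists>s t. s < t \<and> x \<in> {s..t} \<and> t - s < d \<and> P ((u t - u s) / (t - s))"
proof -
  obtain y where y: "y \<noteq> x" "dist y x < d" "P ((u y - u x) / (y - x))"
    using assms unfolding frequently_at by blast
  show ?thesis
  proof (cases "x < y")
    case True
    then show ?thesis using y by (intro exI[of _ x] exI[of _ y]) (auto simp: dist_real_def)
  next
    case False
    have "(u y - u x) / (y - x) = (u x - u y) / (x - y)"
      by (metis minus_diff_eq minus_divide_divide)
    then show ?thesis using y False by (intro exI[of _ y] exI[of _ x]) (auto simp: dist_real_def)
  qed
qed

text \<open>If the lower and upper limits of the quotient differed, it would cross two rationals
  between them; the bound \<open>k\<close> makes their common value finite. Rational thresholds keep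
  the number of exceptional sets countable.\<close>

lemma differentiable_if_no_oscillation:
  fixes u :: "real \<Rightarrow> real"
  defines "Q \<equiv> \<lambda>x y. (u y - u x) / (y - x)"
  assumes bdd: "\<forall>\<^sub>F y in at x. \<bar>Q x y\<bar> \<le> k"
    and osc: "\<And>\<alpha> \<beta>. \<alpha> \<in> \<rat> \<Longrightarrow> \<beta> \<in> \<rat> \<Longrightarrow> \<alpha> < \<beta> \<Longrightarrow> (\<exists>\<^sub>F y in at x. Q x y < \<alpha>) \<Longrightarrow> (\<exists>\<^sub>F y in at x. Q x y > \<beta>) \<Longrightarrow> False"
  shows "u differentiable at x"
proof -
  let ?l = "Liminf (at x) (\<lambda>y. ereal (Q x y))" and ?L = "Limsup (at x) (\<lambda>y. ereal (Q x y))"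
  have "\<not> ?l < ?L"
  proof
    assume "?l < ?L"
    then obtain p where p: "?l < ereal p" "ereal p < ?L" using ereal_dense2 by blast
    from ereal_dense2[OF p(2)] obtain q where q: "p < q" "ereal q < ?L" by auto
    from Rats_dense_in_real[OF q(1)] obtain \<alpha> where \<alpha>: "\<alpha> \<in> \<rat>" "p < \<alpha>" "\<alpha> < q" by blast
    from Rats_dense_in_real[OF \<alpha>(3)] obtain \<beta> where \<beta>: "\<beta> \<in> \<rat>" "\<alpha> < \<beta>" "\<beta> < q" by blast
    have "\<exists>\<^sub>F y in at x. Q x y < \<alpha>"
    proof (rule ccontr)
      assume "\<not> ?thesis"
      then have "\<forall>\<^sub>F y in at x. ereal p \<le> ereal (Q x y)"
        unfolding not_frequently by (rule eventually_mono) (use \<alpha> in auto)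
      from Liminf_bounded[OF this] show False using p(1) by simp
    qed
    moreover have "\<exists>\<^sub>F y in at x. Q x y > \<beta>"
    proof (rule ccontr)
      assume "\<not> ?thesis"
      then have "\<forall>\<^sub>F y in at x. ereal (Q x y) \<le> ereal q"
        unfolding not_frequently by (rule eventually_mono) (use \<beta> in auto)
      from Limsup_bounded[OF this] show False using q(2) by simp
    qed
    ultimately show False using osc[OF \<alpha>(1) \<beta>(1,2)] by blast
  qed
  moreover have "?l \<le> ?L" by (rule Liminf_le_Limsup) simp
  ultimately have "?L = ?l" by simp
  then have lim: "((\<lambda>y. ereal (Q x y)) \<longlongrightarrow> ?l) (at x)"
    by (intro tendsto_Liminf) auto
  have "\<forall>\<^sub>F y in at x. ereal (-k) \<le> ereal (Q x y)" "\<forall>\<^sub>F y in at x. ereal (Q x y) \<le> ereal k"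
    using bdd by (auto elim!: eventually_mono)
  from Liminf_bounded[OF this(1)] Limsup_bounded[OF this(2)]
  have "ereal (-k) \<le> ?l" "?l \<le> ereal k" using \<open>?L = ?l\<close> by auto
  then obtain D where "?l = ereal D" by (cases ?l) auto
  with lim have "(Q x \<longlongrightarrow> D) (at x)" by (simp add: lim_ereal)
  then have "(u has_field_derivative D) (at x)"
    unfolding has_field_derivative_iff Q_def .
  then show ?thesis unfolding real_differentiable_def by blast
qed

text \<open>The exceptional points have unbounded quotients, a null set by steepness, or oscillate
  across one of countably many rational pairs, each giving a null set.\<close>

theorem bounded_variation_imp_differentiable_ae:
  assumes bv: "bounded_variation_by B u a b"
  shows "negligible {x \<in> {a<..<b}. \<not> u differentiable at x}"
proof (cases "a \<le> b")
  case ab: True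
  define Q where "Q = (\<lambda>x y. (u y - u x) / (y - x))"
  define A where "A = {x \<in> {a<..<b}. \<forall>k. \<exists>\<^sub>F y in at x. \<bar>Q x y\<bar> > k}"
  define O' where "O' = (\<lambda>(\<alpha>, \<beta>). {x \<in> {a<..<b}. (\<exists>\<^sub>F y in at x. Q x y < \<alpha>) \<and> (\<exists>\<^sub>F y in at x. Q x y > \<beta>)})"
  let ?P = "{(\<alpha>, \<beta>). \<alpha> \<in> \<rat> \<and> \<beta> \<in> \<rat> \<and> \<alpha> < (\<beta>::real)}"
  have "negligible A"
  proof (rule bounded_variation_steep_negligible[OF bv])
    fix x k d assume "x \<in> A" "(d::real) > 0"
    then have "\<exists>s t. s < t \<and> x \<in> {s..t} \<and> t - s < d \<and> \<bar>(u t - u s) / (t - s)\<bar> > k"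
      by (intro difference_quotient_interval) (auto simp: A_def Q_def)
    then obtain s t where "s < t" "x \<in> {s..t}" "t - s < d" "\<bar>u t - u s\<bar> / (t - s) > k"
      by (auto simp: abs_divide)
    then show "\<exists>s t. s < t \<and> x \<in> {s..t} \<and> t - s < d \<and> \<bar>u t - u s\<bar> > k * (t - s)"
      by (intro exI[of _ s] exI[of _ t]) (simp add: pos_less_divide_eq)
  qed (auto simp: A_def)
  moreover have "negligible (O' (\<alpha>, \<beta>))" if "\<alpha> < \<beta>" for \<alpha> \<beta>
  proof -
    \<comment> \<open>For \<open>u x - m * x\<close>, slopes above \<open>\<beta>\<close> and below
      \<open>\<alpha>\<close> become slopes above \<open>c\<close> and below
      \<open>- c\<close>.\<close>
    define m c where "m = (\<alpha> + \<beta>) / 2" and "c = (\<beta> - \<alpha>) / 2"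
    have eq: "m + c = \<beta>" "m - c = \<alpha>" by (simp_all add: m_def c_def field_simps)
    show ?thesis
    proof (rule bounded_variation_oscillation_negligible[OF bounded_variation_by_diff_linear[OF bv ab, of m]])
      show "c > 0" using that by (simp add: c_def)
      fix x d assume x: "x \<in> O' (\<alpha>, \<beta>)" "(d::real) > 0"
      have "\<exists>s t. s < t \<and> x \<in> {s..t} \<and> t - s < d \<and> (u t - u s) / (t - s) > \<beta>"
        using x by (intro difference_quotient_interval) (auto simp: O'_def Q_def)
      then obtain s t where st: "s < t" "x \<in> {s..t}" "t - s < d" "(u t - u s) / (t - s) > m + c"
        unfolding eq by blast
      then have "(m + c) * (t - s) < u t - u s" by (simp add: pos_less_divide_eq)
      with st show "\<exists>s t. s < t \<and> x \<in> {s..t} \<and> t - s < d \<and> (u t - m * t) - (u s - m * s) > c * (t - s)"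
        by (intro exI[of _ s] exI[of _ t]) (auto simp: algebra_simps)
      have "\<exists>s t. s < t \<and> x \<in> {s..t} \<and> t - s < d \<and> (u t - u s) / (t - s) < \<alpha>"
        using x by (intro difference_quotient_interval) (auto simp: O'_def Q_def)
      then obtain s t where st: "s < t" "x \<in> {s..t}" "t - s < d" "(u t - u s) / (t - s) < m - c"
        unfolding eq by blast
      then have "u t - u s < (m - c) * (t - s)" by (simp add: pos_divide_less_eq)
      with st show "\<exists>s t. s < t \<and> x \<in> {s..t} \<and> t - s < d \<and> (u t - m * t) - (u s - m * s) < - c * (t - s)"
        by (intro exI[of _ s] exI[of _ t]) (auto simp: algebra_simps)
    qed (auto simp: O'_def)
  qed
  moreover have "countable ?P"
    by (rule countable_subset[of _ "\<rat> \<times> \<rat>"]) (auto simp: countable_rat)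
  ultimately have "negligible (A \<union> \<Union>(O' ` ?P))"
    by (intro negligible_Un negligible_countable_Union) auto
  then show ?thesis
  proof (rule negligible_subset, safe)
    fix x assume x: "x \<in> {a<..<b}" "\<not> u differentiable at x" "x \<notin> \<Union>(O' ` ?P)"
    show "x \<in> A"
    proof (rule ccontr)
      assume "x \<notin> A"
      then obtain k where "\<forall>\<^sub>F y in at x. \<bar>Q x y\<bar> \<le> k"
        using x(1) by (auto simp: A_def not_frequently not_less)
      then have "u differentiable at x"
        unfolding Q_def by (rule differentiable_if_no_oscillation) (use x in \<open>auto simp: O'_def Q_def\<close>)
      then show False using x(2) by simp
    qed
  qed
qed auto

text \<open>Negligibility is local, and on a neighbourhood of \<open>x\<close> shorter than the
  \<open>d\<close> that absolute continuity assigns to \<open>1\<close> the variation is at most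
  \<open>1\<close>.\<close>

lemma loc_abs_cont_pos_differentiable_ae:
  assumes "loc_abs_cont_pos u"
  shows "negligible {x. 0 < x \<and> \<not> u differentiable at x}" (is "negligible ?S")
proof (rule locally_negligible_alt[THEN iffD2], rule ballI)
  fix x assume x: "x \<in> ?S"
  then have "0 < x/2" "x/2 \<le> 2*x" by auto
  then have ac: "abs_cont_on_interval u (x/2) (2*x)"
    using assms unfolding loc_abs_cont_pos_def by blast
  obtain d where "d > 0" and
    d: "\<And>D. D division_of \<Union>D \<Longrightarrow> \<Union>D \<subseteq> {x/2..2*x} \<Longrightarrow> sum (measure lborel) D < d \<Longrightarrow> (\<Sum>K\<in>D. \<bar>increment u K\<bar>) < 1"
    by (rule abs_cont_on_interval_division[OF ac zero_less_one]) (rule that)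
  \<comment> \<open>The bound \<open>x/2\<close> keeps the neighbourhood inside
    \<open>{x/2..2*x}\<close>; \<open>d/3\<close> makes its length \<open>2 * h\<close> less than
    \<open>d\<close>.\<close>
  define h where "h = min (x/2) (d/3)"
  have h: "h > 0" "h \<le> x/2" "2 * h < d" using x \<open>d > 0\<close> by (auto simp: h_def)
  have "bounded_variation_by 1 u (x - h) (x + h)"
    unfolding bounded_variation_by_def
  proof (intro allI impI)
    fix D assume D: "D division_of \<Union>D" "\<Union>D \<subseteq> {x - h..x + h}"
    have "sum (measure lborel) D \<le> 2 * h"
      using subadditive_content_division[OF D(1), of "x - h" "x + h"] D(2) h by simp
    then have "(\<Sum>K\<in>D. \<bar>increment u K\<bar>) < 1"
      using D h by (intro d) auto
    then show "(\<Sum>K\<in>D. \<bar>increment u K\<bar>) \<le> 1" by simp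
  qed
  then have "negligible {y \<in> {x - h<..<x + h}. \<not> u differentiable at y}"
    by (rule bounded_variation_imp_differentiable_ae)
  then have "negligible (?S \<inter> {x - h<..<x + h})"
    by (rule negligible_subset) auto
  moreover have "openin (top_of_set ?S) (?S \<inter> {x - h<..<x + h})"
    by (rule openin_open_Int) simp
  ultimately show "\<exists>U. openin (top_of_set ?S) U \<and> x \<in> U \<and> negligible U"
    using x h by (intro exI[of _ "?S \<inter> {x - h<..<x + h}"]) auto
qed

section \<open>Fundamental theorem of calculus for absolutely continuous functions\<close>

text \<open>As \<open>x\<close> lies between \<open>k\<close> and \<open>l\<close>, the errors
  \<open>e * (x - k)\<close> and \<open>e * (l - x)\<close> of the two halves add up to the
  bound.\<close>

lemma derivative_straddle:
  fixes u :: "real \<Rightarrow> real"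
  assumes "(u has_real_derivative D) (at x)" "e > 0"
  shows "\<exists>d>0. \<forall>k l. k \<le> x \<longrightarrow> x \<le> l \<longrightarrow> {k..l} \<subseteq> ball x d \<longrightarrow> \<bar>(l - k) * D - (u l - u k)\<bar> \<le> e * (l - k)"
proof -
  have "(u has_derivative (*) D) (at x within UNIV)"
    using assms(1) by (simp add: has_field_derivative_def)
  then obtain d where "d > 0" and d: "\<And>y. \<bar>y - x\<bar> < d \<Longrightarrow> \<bar>u y - u x - D * (y - x)\<bar> \<le> e * \<bar>y - x\<bar>"
    using assms(2) unfolding has_derivative_within_alt by (auto simp: real_norm_def)
  show ?thesis
  proof (intro exI[of _ d] conjI allI impI)
    fix k l assume kl: "k \<le> x" "x \<le> l" "{k..l} \<subseteq> ball x d"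
    then have "k \<in> ball x d" "l \<in> ball x d"
      by (meson atLeastAtMost_iff order_refl order_trans subsetD)+
    then have "\<bar>u k - u x - D * (k - x)\<bar> \<le> e * (x - k)" "\<bar>u l - u x - D * (l - x)\<bar> \<le> e * (l - x)"
      using d[of k] d[of l] kl by (auto simp: dist_real_def)
    moreover have "(l - k) * D - (u l - u k) = (u k - u x - D * (k - x)) - (u l - u x - D * (l - x))"
      and "e * (l - k) = e * (x - k) + e * (l - x)"
      by (simp_all add: algebra_simps)
    ultimately show "\<bar>(l - k) * D - (u l - u k)\<bar> \<le> e * (l - k)" by linarith
  qed fact
qed

lemma negligible_open_superset:
  fixes N :: "real set"
  assumes "negligible N" "e > 0"
  obtains U where "open U" "N \<subseteq> U" "U \<in> lmeasurable" "measure lebesgue U < e"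
proof -
  have N: "N \<in> null_sets lebesgue" using assms(1) by (simp add: negligible_iff_null_sets)
  then have "N \<in> sets lebesgue" by blast
  from sets_lebesgue_outer_open[OF this assms(2)] obtain U where U: "open U" "N \<subseteq> U"
    "U - N \<in> lmeasurable" "emeasure lebesgue (U - N) < ennreal e" by blast
  have Um: "U \<in> sets lebesgue" using U(1) by (auto intro: sets_completionI_sets)
  then have "emeasure lebesgue U < ennreal e"
    using U(4) emeasure_Diff_null_set[OF N Um] by simp
  moreover from this have "U \<in> lmeasurable"
    using Um by (intro fmeasurableI) (auto intro: less_trans)
  ultimately show ?thesis
    using that[OF U(1,2)] by (simp add: emeasure_eq_measure2 ennreal_less_iff)
qed

text \<open>The gauge confines the intervals tagged in the exceptional set to an open set of small
  measure, where absolute continuity controls the increments.\<close>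

theorem abs_cont_has_integral_derivative:
  assumes ac: "abs_cont_on_interval u a b" and "a \<le> b" and N: "negligible N"
    and der: "\<And>x. x \<in> {a..b} \<Longrightarrow> x \<notin> N \<Longrightarrow> (u has_real_derivative f x) (at x)"
  shows "(f has_integral (u b - u a)) {a..b}"
proof (rule has_integral_spike[OF N])
  \<comment> \<open>The value \<open>0\<close> on \<open>N\<close> removes the length terms of
    intervals tagged there, leaving only their increments to control.\<close>
  let ?g = "\<lambda>x. if x \<in> N then 0 else f x"
  show "f x = ?g x" if "x \<in> {a..b} - N" for x using that by simp
  show "(?g has_integral (u b - u a)) {a..b}"
    unfolding has_integral_real
  proof (intro allI impI)
    fix e :: real assume "e > 0"
    then have "e / 2 > 0" by simp
    obtain \<delta> where "\<delta> > 0" and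
      \<delta>: "\<And>D. D division_of \<Union>D \<Longrightarrow> \<Union>D \<subseteq> {a..b} \<Longrightarrow> sum (measure lborel) D < \<delta> \<Longrightarrow> (\<Sum>K\<in>D. \<bar>increment u K\<bar>) < e / 2"
      by (rule abs_cont_on_interval_division[OF ac \<open>e / 2 > 0\<close>]) (rule that)
    obtain U where U: "open U" "N \<subseteq> U" "U \<in> lmeasurable" "measure lebesgue U < \<delta>"
      using negligible_open_superset[OF N \<open>\<delta> > 0\<close>] by blast
    \<comment> \<open>One half of \<open>e\<close> is spent on tags outside \<open>N\<close>, the
      other on tags in \<open>N\<close>; the \<open>1\<close> prevents division by zero when
      \<open>a = b\<close>.\<close>
    define \<eta> where "\<eta> = e / (2 * (b - a + 1))"
    have "\<eta> > 0" "\<eta> * (b - a) \<le> e / 2"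
      using \<open>e > 0\<close> \<open>a \<le> b\<close> by (auto simp: \<eta>_def field_simps)
    have "\<exists>d>0. x \<in> {a..b} - N \<longrightarrow> (\<forall>k l. k \<le> x \<longrightarrow> x \<le> l \<longrightarrow> {k..l} \<subseteq> ball x d \<longrightarrow>
        \<bar>(l - k) * f x - (u l - u k)\<bar> \<le> \<eta> * (l - k))" for x
    proof (cases "x \<in> {a..b} - N")
      case True
      then show ?thesis using derivative_straddle[OF der \<open>\<eta> > 0\<close>, of x] by blast
    qed (auto intro: exI[of _ 1])
    then obtain d where d: "\<And>x. d x > 0" "\<And>x k l. x \<in> {a..b} - N \<Longrightarrow> k \<le> x \<Longrightarrow> x \<le> l \<Longrightarrow> {k..l} \<subseteq> ball x (d x) \<Longrightarrow>
        \<bar>(l - k) * f x - (u l - u k)\<bar> \<le> \<eta> * (l - k)"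
      by metis
    define \<gamma> where "\<gamma> x = (if x \<in> N then U else ball x (d x))" for x
    have gauge: "gauge \<gamma>" using U d(1) by (auto simp: gauge_def \<gamma>_def)
    have bound: "norm ((\<Sum>(x, K)\<in>p. measure lborel K *\<^sub>R ?g x) - (u b - u a)) < e"
      if p: "p tagged_division_of {a..b}" "\<gamma> fine p" for p
    proof -
      note pp = tagged_division_ofD[OF p(1)]
      define q where "q = {(x, K) \<in> p. x \<in> N}"
      have "q \<subseteq> p" by (auto simp: q_def)
      have pq: "p tagged_partial_division_of {a..b}" using p(1) by (simp add: tagged_division_of_def)
      then have q: "q tagged_partial_division_of {a..b}"
        using \<open>q \<subseteq> p\<close> by (rule tagged_partial_division_subset)
      have qdiv: "snd ` q division_of \<Union>(snd ` q)"
        by (rule partial_division_of_tagged_division[OF q])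
      have qU: "\<Union>(snd ` q) \<subseteq> U"
        using p(2) \<open>q \<subseteq> p\<close> unfolding fine_def \<gamma>_def q_def by fastforce
      have "sum (measure lborel) (snd ` q) < \<delta>"
        using sum_measure_division_le[OF qdiv qU U(3)] U(4) by simp
      moreover have "\<Union>(snd ` q) \<subseteq> {a..b}"
        using pp(3) \<open>q \<subseteq> p\<close> by fastforce
      ultimately have "(\<Sum>K\<in>snd ` q. \<bar>increment u K\<bar>) < e / 2"
        using qdiv by (intro \<delta>) auto
      moreover have "(\<Sum>(x, K)\<in>q. \<bar>increment u K\<bar>) = (\<Sum>K\<in>snd ` q. \<bar>increment u K\<bar>)"
      proof -
        \<comment> \<open>Passing from tagged to untagged sums requires the value \<open>0\<close>
          on empty intervals, where \<open>increment u {}\<close> is the uninformative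
          \<open>u (Sup {}) - u (Inf {})\<close>.\<close>
        let ?i = "\<lambda>K. if K = {} then 0 else \<bar>increment u K\<bar>"
        have ne: "K \<noteq> {}" if "(x, K) \<in> q" for x K
          using that pp(2) \<open>q \<subseteq> p\<close> by blast
        have "(\<Sum>(x, K)\<in>q. ?i K) = (\<Sum>K\<in>snd ` q. ?i K)"
        proof (rule sum.over_tagged_division_lemma[OF tagged_partial_division_of_Union_self[OF q]])
          show "?i (cbox k l) = 0" if "box k l = {}" for k l :: real
            using that by (cases "k = l") auto
        qed
        moreover have "(\<Sum>(x, K)\<in>q. ?i K) = (\<Sum>(x, K)\<in>q. \<bar>increment u K\<bar>)"
          by (rule sum.cong) (use ne in auto)
        moreover have "(\<Sum>K\<in>snd ` q. ?i K) = (\<Sum>K\<in>snd ` q. \<bar>increment u K\<bar>)"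
          by (rule sum.cong) (use ne in auto)
        ultimately show ?thesis by simp
      qed
      ultimately have small: "(\<Sum>(x, K)\<in>q. \<bar>increment u K\<bar>) < e / 2" by simp
      let ?h = "\<lambda>(x, K). measure lborel K * ?g x - increment u K"
      have "(\<Sum>(x, K)\<in>p. measure lborel K *\<^sub>R ?g x) - (u b - u a) = sum ?h p"
        using additive_tagged_division_1[OF \<open>a \<le> b\<close> p(1), of u]
        by (simp add: sum_subtractf increment_def case_prod_unfold)
      also have "\<bar>\<dots>\<bar> \<le> (\<Sum>z\<in>p. \<bar>?h z\<bar>)" by (rule sum_abs)
      also have "\<dots> = (\<Sum>z\<in>q. \<bar>?h z\<bar>) + (\<Sum>z\<in>p - q. \<bar>?h z\<bar>)"
        using sum.subset_diff[OF \<open>q \<subseteq> p\<close> pp(1), of "\<lambda>z. \<bar>?h z\<bar>"] by simp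
      also have "(\<Sum>z\<in>q. \<bar>?h z\<bar>) = (\<Sum>(x, K)\<in>q. \<bar>increment u K\<bar>)"
        by (rule sum.cong) (auto simp: q_def)
      also have "(\<Sum>z\<in>p - q. \<bar>?h z\<bar>) \<le> (\<Sum>z\<in>p - q. \<eta> * measure lborel (snd z))"
      proof (rule sum_mono)
        fix z assume "z \<in> p - q"
        then obtain x K where z: "z = (x, K)" and xK: "(x, K) \<in> p" "(x, K) \<notin> q"
          by (cases z) auto
        then have "x \<notin> N" by (simp add: q_def)
        have x: "x \<in> K" "K \<subseteq> {a..b}" using pp(2,3) xK(1) by auto
        obtain k l where K: "K = {k..l}" using pp(4)[OF xK(1)] by auto
        have "{k..l} \<subseteq> ball x (d x)"
          using p(2) xK(1) \<open>x \<notin> N\<close> unfolding K fine_def \<gamma>_def by fastforce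
        then show "\<bar>?h z\<bar> \<le> \<eta> * measure lborel (snd z)"
          using d(2)[of x k l] x \<open>x \<notin> N\<close> unfolding K z by auto
      qed
      also have "\<dots> \<le> (\<Sum>z\<in>p. \<eta> * measure lborel (snd z))"
        by (rule sum_mono2) (use pp(1) \<open>\<eta> > 0\<close> in auto)
      also have "\<dots> = \<eta> * (b - a)"
        using additive_content_tagged_division[of p a b] p(1) \<open>a \<le> b\<close>
        by (simp add: sum_distrib_left[symmetric] case_prod_unfold)
      also note \<open>\<eta> * (b - a) \<le> e / 2\<close>
      finally show ?thesis using small by simp
    qed
    show "\<exists>\<gamma>. gauge \<gamma> \<and> (\<forall>p. p tagged_division_of {a..b} \<and> \<gamma> fine p \<longrightarrow>
        norm ((\<Sum>(x, K)\<in>p. measure lborel K *\<^sub>R ?g x) - (u b - u a)) < e)"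
      by (rule exI[of _ \<gamma>], rule conjI[OF gauge], intro allI impI, elim conjE, rule bound)
  qed
qed

section \<open>Consequences for locally absolutely continuous functions on the half-line\<close>

lemma loc_abs_cont_pos_has_integral_deriv:
  assumes "loc_abs_cont_pos u" "0 < a" "a \<le> b"
  shows "(deriv u has_integral (u b - u a)) {a..b}"
proof (rule abs_cont_has_integral_derivative)
  show "abs_cont_on_interval u a b" using assms by (simp add: loc_abs_cont_pos_def)
  show "negligible {x. 0 < x \<and> \<not> u differentiable at x}"
    using assms(1) by (rule loc_abs_cont_pos_differentiable_ae)
  show "(u has_real_derivative deriv u x) (at x)"
    if "x \<in> {a..b}" "x \<notin> {x. 0 < x \<and> \<not> u differentiable at x}" for x
    using that assms(2) by (auto simp: DERIV_deriv_iff_real_differentiable)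
qed fact

text \<open>Gauge integrability gives measurability on each compact interval \<open>?J n\<close>,
  and these intervals exhaust the half-line.\<close>

lemma loc_abs_cont_pos_deriv_measurable:
  assumes "loc_abs_cont_pos u"
  shows "(\<lambda>x. indicator {0<..} x * deriv u x) \<in> borel_measurable lebesgue"
proof (rule borel_measurable_LIMSEQ_real)
  let ?J = "\<lambda>n::nat. {1 / (real n + 1)..real n + 1}"
  have Jne: "1 / (real n + 1) \<le> real n + 1" "0 < 1 / (real n + 1)" for n
    by (auto simp: field_simps)
  show "(\<lambda>x. indicator (?J n) x * deriv u x) \<in> borel_measurable lebesgue" for n
    using has_integral_implies_lebesgue_measurable[OF loc_abs_cont_pos_has_integral_deriv[OF assms Jne(2,1)]]
    by simp
  fix x :: real
  show "(\<lambda>n. indicator (?J n) x * deriv u x) \<longlonglongrightarrow> indicator {0<..} x * deriv u x"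
  proof (cases "x > 0")
    case True
    have "\<forall>\<^sub>F n in sequentially. real n \<ge> max x (1 / x)"
      by (rule eventually_ge_at_top[THEN filterlim_real_sequentially[unfolded filterlim_iff, rule_format]])
    then have "\<forall>\<^sub>F n in sequentially. indicator (?J n) x * deriv u x = indicator {0<..} x * deriv u x"
    proof eventually_elim
      case (elim n)
      then have "1 \<le> x * real n" using True by (simp add: field_simps)
      then have "1 \<le> x * (real n + 1)" using True by (simp add: algebra_simps)
      then have "x \<in> ?J n" using elim True by (simp add: field_simps)
      then show ?case using True by simp
    qed
    then show ?thesis by (rule tendsto_eventually)
  next
    case False
    then have "\<not> 1 / (real n + 1) \<le> x" for n using Jne(2)[of n] by linarith
    then have "indicator (?J n) x = (0::real)" for n by (simp add: indicator_def)
    then show ?thesis using False by simp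
  qed
qed

text \<open>Gauge integrability is not absolute. A finite right-hand side, however, makes
  \<open>deriv u\<close> Lebesgue integrable on \<open>{a..b}\<close>; there the two integrals agree
  and the norm bound applies.\<close>

lemma loc_abs_cont_pos_increment_le:
  assumes "loc_abs_cont_pos u" "0 < a" "a \<le> b"
  shows "ennreal \<bar>u b - u a\<bar> \<le> (\<integral>\<^sup>+x\<in>{a..b}. ennreal \<bar>deriv u x\<bar> \<partial>lebesgue)"
proof (cases "(\<integral>\<^sup>+x\<in>{a..b}. ennreal \<bar>deriv u x\<bar> \<partial>lebesgue) = \<infinity>")
  case False
  note I = loc_abs_cont_pos_has_integral_deriv[OF assms]
  let ?f = "\<lambda>x. indicator {a..b} x *\<^sub>R deriv u x"
  have nn: "(\<integral>\<^sup>+x. ennreal (norm (?f x)) \<partial>lebesgue) = (\<integral>\<^sup>+x\<in>{a..b}. ennreal \<bar>deriv u x\<bar> \<partial>lebesgue)"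
    by (rule nn_integral_cong) (simp split: split_indicator)
  have int: "integrable lebesgue ?f"
    using False has_integral_implies_lebesgue_measurable[OF I] unfolding nn[symmetric]
    by (intro integrableI_bounded) (auto simp: top.not_eq_extremum)
  then have "(deriv u has_integral integral\<^sup>L lebesgue ?f) {a..b}"
    using has_integral_set_lebesgue[of "{a..b}" "deriv u"]
    by (simp add: set_integrable_def set_lebesgue_integral_def)
  then have "integral\<^sup>L lebesgue ?f = u b - u a"
    using I by (rule has_integral_unique)
  then show ?thesis
    using integral_norm_bound_ennreal[OF int] nn by simp
qed simp

section \<open>Maximal function of initial averages\<close>

text \<open>\<open>enn2real\<close> sends an infinite integral to \<open>0\<close>, so this is a
  true mean only where the integral is finite, as \<open>bounded_profile\<close> ensures.\<close>

definition initial_average :: "(real \<Rightarrow> real) \<Rightarrow> real \<Rightarrow> real" where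
  "initial_average f s = enn2real (\<integral>\<^sup>+x\<in>{0<..s}. ennreal (f x) \<partial>lborel) / s"

text \<open>Intersecting with \<open>{0<..}\<close> keeps the index set sensible for
  \<open>r \<le> 0\<close> too; for bounded profiles the function is then monotone on the whole
  line, hence Borel.\<close>

definition maximal_average :: "(real \<Rightarrow> real) \<Rightarrow> real \<Rightarrow> real" where
  "maximal_average f r = (SUP s\<in>{r..} \<inter> {0<..}. initial_average f s)"

text \<open>The layer-cake formula, used with \<open>a = p\<close> and \<open>a = p - 1\<close>. For
  \<open>p < 2\<close> the latter has a negative exponent, still above \<open>-1\<close> and so
  integrable at \<open>0\<close>.\<close>

lemma nn_integral_layer_powr:
  assumes "a > 0" "y \<ge> 0"
  shows "(\<integral>\<^sup>+l. (if 0 < l \<and> l < y then ennreal (a * l powr (a - 1)) else 0) \<partial>lborel) = ennreal (y powr a)"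
proof -
  have "((\<lambda>l. l powr (a - 1)) has_integral (y powr (a - 1 + 1) / (a - 1 + 1))) {0..y}"
    using assms by (intro has_integral_powr_from_0) auto
  from has_integral_mult_right[OF this, of a]
  have "((\<lambda>l. a * l powr (a - 1)) has_integral (y powr a)) {0..y}"
    using assms by simp
  then have "(\<integral>\<^sup>+l. indicator {0..y} l * (a * l powr (a - 1)) \<partial>lborel) = ennreal (y powr a)"
    using assms by (intro nn_integral_has_integral_lebesgue) auto
  moreover have "(\<integral>\<^sup>+l. (if 0 < l \<and> l < y then ennreal (a * l powr (a - 1)) else 0) \<partial>lborel)
      = (\<integral>\<^sup>+l. indicator {0..y} l * (a * l powr (a - 1)) \<partial>lborel)"
  proof (rule nn_integral_cong_AE)
    show "AE l in lborel. (if 0 < l \<and> l < y then ennreal (a * l powr (a - 1)) else 0)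
        = ennreal (indicator {0..y} l * (a * l powr (a - 1)))"
      using AE_lborel_singleton[of 0] AE_lborel_singleton[of y]
      by eventually_elim (auto simp: indicator_def)
  qed
  ultimately show ?thesis by simp
qed

text \<open>The bound makes every mean finite; bound and support together make the integral of
  \<open>\<Phi> powr p\<close> finite, which permits absorption.\<close>

locale bounded_profile =
  fixes f :: "real \<Rightarrow> real" and B T :: real
  assumes borel[measurable]: "f \<in> borel_measurable borel"
    and nonneg: "\<And>x. 0 \<le> f x" and le: "\<And>x. f x \<le> B"
    and support: "\<And>x. x > T \<Longrightarrow> f x = 0"
begin

abbreviation "\<Phi> \<equiv> maximal_average f"

lemma B_nonneg: "0 \<le> B"
  using nonneg le order_trans by blast

lemma nn_integral_initial:
  assumes "s > 0"
  shows "(\<integral>\<^sup>+x\<in>{0<..s}. ennreal (f x) \<partial>lborel) = ennreal (s * initial_average f s)"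
    and "initial_average f s \<le> B"
proof -
  have "(\<integral>\<^sup>+x\<in>{0<..s}. ennreal (f x) \<partial>lborel) \<le> (\<integral>\<^sup>+x\<in>{0<..s}. ennreal B \<partial>lborel)"
    by (intro nn_integral_mono mult_right_mono ennreal_leI le) simp
  also have "\<dots> = ennreal (B * s)"
    using assms B_nonneg by (simp add: nn_integral_cmult_indicator ennreal_mult)
  finally have le: "(\<integral>\<^sup>+x\<in>{0<..s}. ennreal (f x) \<partial>lborel) \<le> ennreal (B * s)" .
  then have "(\<integral>\<^sup>+x\<in>{0<..s}. ennreal (f x) \<partial>lborel) < top"
    using ennreal_less_top by (rule le_less_trans)
  then show "(\<integral>\<^sup>+x\<in>{0<..s}. ennreal (f x) \<partial>lborel) = ennreal (s * initial_average f s)"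
    using assms by (simp add: initial_average_def)
  have "enn2real (\<integral>\<^sup>+x\<in>{0<..s}. ennreal (f x) \<partial>lborel) \<le> B * s"
    using enn2real_mono[OF le] B_nonneg assms by simp
  then show "initial_average f s \<le> B"
    using assms by (simp add: initial_average_def pos_divide_le_eq)
qed

lemma bdd_above_average: "bdd_above (initial_average f ` ({r..} \<inter> {0<..}))"
  by (rule bdd_aboveI2[of _ _ B]) (use nn_integral_initial(2) in auto)

lemma range_nonempty: "{r..} \<inter> {0<..} \<noteq> {}" for r :: real
proof -
  have "max r 1 \<in> {r..} \<inter> {0<..}" by auto
  then show ?thesis by blast
qed

lemma average_le_maximal: "r \<le> s \<Longrightarrow> 0 < s \<Longrightarrow> initial_average f s \<le> \<Phi> r"
  unfolding maximal_average_def by (rule cSUP_upper[OF _ bdd_above_average]) auto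

lemma maximal_antimono: "r \<le> r' \<Longrightarrow> \<Phi> r' \<le> \<Phi> r"
  unfolding maximal_average_def
  by (rule cSUP_subset_mono[OF range_nonempty bdd_above_average]) auto

lemma maximal_nonneg: "0 \<le> \<Phi> r"
proof -
  have "0 \<le> initial_average f (max r 1)" by (simp add: initial_average_def)
  also have "\<dots> \<le> \<Phi> r" by (rule average_le_maximal) auto
  finally show ?thesis .
qed

lemma maximal_le: "\<Phi> r \<le> B"
  unfolding maximal_average_def
  by (rule cSUP_least[OF range_nonempty]) (use nn_integral_initial(2) in auto)

lemma maximal_measurable[measurable]: "\<Phi> \<in> borel_measurable borel"
proof -
  have "mono (\<lambda>r. - \<Phi> r)" using maximal_antimono by (auto intro: monoI)
  then have "(\<lambda>r. - \<Phi> r) \<in> borel_measurable borel" by (rule borel_measurable_mono)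
  then show ?thesis by simp
qed

text \<open>No covering argument is needed: every point of the superlevel set lies in some \<open>{0<..s}\<close>
  contained in it on which the mean of \<open>f\<close> exceeds \<open>l\<close>.\<close>

lemma weak_type:
  assumes "l > 0"
  shows "ennreal l * (\<integral>\<^sup>+r. (if 0 < r \<and> l < \<Phi> r then 1 else 0) \<partial>lborel)
    \<le> (\<integral>\<^sup>+r. (if 0 < r \<and> l < \<Phi> r then ennreal (f r) else 0) \<partial>lborel)" (is "_ \<le> ?R")
proof (cases "?R = \<infinity>")
  case False
  then obtain c where c: "?R = ennreal c" "c \<ge> 0" by (cases ?R) auto
  \<comment> \<open>If the mean on \<open>(0, s)\<close> exceeds \<open>l\<close>, then
    \<open>l * s\<close> is at most the integral over \<open>{0<..s}\<close>, which lies in the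
    superlevel set. So that whole set is contained in \<open>{0..c / l}\<close>.\<close>
  have bound: "r \<le> c / l" if r: "0 < r" "l < \<Phi> r" for r
  proof -
    obtain s where s: "r \<le> s" "0 < s" "l < initial_average f s"
      using r(2) unfolding maximal_average_def less_cSUP_iff[OF range_nonempty bdd_above_average] by auto
    have "ennreal (l * s) \<le> ennreal (s * initial_average f s)"
      using s by (intro ennreal_leI) simp
    also have "\<dots> = (\<integral>\<^sup>+x\<in>{0<..s}. ennreal (f x) \<partial>lborel)"
      using nn_integral_initial(1)[OF s(2)] by simp
    also have "\<dots> \<le> ?R"
    proof (rule nn_integral_mono)
      fix x
      have "l < \<Phi> x" if "0 < x" "x \<le> s"
        using s(3) average_le_maximal[OF that(2) s(2)] by simp
      then show "ennreal (f x) * indicator {0<..s} x \<le> (if 0 < x \<and> l < \<Phi> x then ennreal (f x) else 0)"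
        by (auto simp: indicator_def)
    qed
    finally have "l * s \<le> c" using c by simp
    then have "s \<le> c / l" using assms by (simp add: pos_le_divide_eq mult.commute)
    with s(1) show ?thesis by simp
  qed
  have "(\<integral>\<^sup>+r. (if 0 < r \<and> l < \<Phi> r then 1 else 0) \<partial>lborel) \<le> (\<integral>\<^sup>+r. indicator {0..c / l} r \<partial>lborel)"
    by (rule nn_integral_mono) (use bound in \<open>auto simp: indicator_def\<close>)
  also have "\<dots> = ennreal (c / l)" using assms c(2) by simp
  finally have "ennreal l * (\<integral>\<^sup>+r. (if 0 < r \<and> l < \<Phi> r then 1 else 0) \<partial>lborel) \<le> ennreal l * ennreal (c / l)"
    by (rule mult_left_mono) simp
  also have "\<dots> = ennreal c" using assms c(2) by (simp flip: ennreal_mult)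
  finally show ?thesis using c by simp
qed simp

text \<open>The factor \<open>p / (p - 1)\<close> appears after Tonelli, when
  \<open>p * l powr (p - 2)\<close> is integrated over \<open>0 < l < \<Phi> r\<close>.\<close>

lemma maximal_powr_le:
  assumes p: "1 < p"
  shows "(\<integral>\<^sup>+r\<in>{0<..}. ennreal (\<Phi> r powr p) \<partial>lborel)
    \<le> (\<integral>\<^sup>+r\<in>{0<..}. ennreal (p / (p - 1) * f r * \<Phi> r powr (p - 1)) \<partial>lborel)"
proof -
  let ?P = "\<lambda>r l. 0 < r \<and> 0 < l \<and> l < \<Phi> r"
  let ?h = "\<lambda>l. ennreal (p * l powr (p - 1))"
  let ?k = "\<lambda>l. ennreal (p * l powr (p - 2))"
  have "(\<integral>\<^sup>+r\<in>{0<..}. ennreal (\<Phi> r powr p) \<partial>lborel)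
      = (\<integral>\<^sup>+r. (\<integral>\<^sup>+l. (if ?P r l then ?h l else 0) \<partial>lborel) \<partial>lborel)"
  proof (rule nn_integral_cong)
    fix r :: real
    show "ennreal (\<Phi> r powr p) * indicator {0<..} r = (\<integral>\<^sup>+l. (if ?P r l then ?h l else 0) \<partial>lborel)"
      using nn_integral_layer_powr[of p "\<Phi> r"] p maximal_nonneg[of r] by (cases "0 < r") auto
  qed
  also have "\<dots> = (\<integral>\<^sup>+l. (\<integral>\<^sup>+r. (if ?P r l then ?h l else 0) \<partial>lborel) \<partial>lborel)"
    by (rule lborel_pair.Fubini') measurable
  also have "\<dots> \<le> (\<integral>\<^sup>+l. (\<integral>\<^sup>+r. (if ?P r l then ?k l * ennreal (f r) else 0) \<partial>lborel) \<partial>lborel)"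
  proof (rule nn_integral_mono)
    fix l :: real
    show "(\<integral>\<^sup>+r. (if ?P r l then ?h l else 0) \<partial>lborel)
      \<le> (\<integral>\<^sup>+r. (if ?P r l then ?k l * ennreal (f r) else 0) \<partial>lborel)"
    proof (cases "l > 0")
      case True
      \<comment> \<open>One factor \<open>l\<close> is split off, to be consumed by the weak-type
        bound.\<close>
      have "l powr (p - 1) = l powr (p - 2) * l"
        using True powr_add[of l "p - 2" 1] by simp
      then have hk: "?h l = ?k l * ennreal l"
        using True p by (simp add: ennreal_mult[symmetric])
      have "(\<integral>\<^sup>+r. (if ?P r l then ?h l else 0) \<partial>lborel)
          = (\<integral>\<^sup>+r. ?h l * (if 0 < r \<and> l < \<Phi> r then 1 else 0) \<partial>lborel)"
        by (rule nn_integral_cong) (use True in auto)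
      also have "\<dots> = ?k l * (ennreal l * (\<integral>\<^sup>+r. (if 0 < r \<and> l < \<Phi> r then 1 else 0) \<partial>lborel))"
        unfolding hk by (subst nn_integral_cmult) (auto simp: mult.assoc)
      also have "\<dots> \<le> ?k l * (\<integral>\<^sup>+r. (if 0 < r \<and> l < \<Phi> r then ennreal (f r) else 0) \<partial>lborel)"
        by (rule mult_left_mono[OF weak_type[OF True]]) simp
      also have "\<dots> = (\<integral>\<^sup>+r. ?k l * (if 0 < r \<and> l < \<Phi> r then ennreal (f r) else 0) \<partial>lborel)"
        by (rule nn_integral_cmult[symmetric]) measurable
      also have "\<dots> = (\<integral>\<^sup>+r. (if ?P r l then ?k l * ennreal (f r) else 0) \<partial>lborel)"
        by (rule nn_integral_cong) (use True in auto)
      finally show ?thesis .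
    qed simp
  qed
  also have "\<dots> = (\<integral>\<^sup>+r. (\<integral>\<^sup>+l. (if ?P r l then ?k l * ennreal (f r) else 0) \<partial>lborel) \<partial>lborel)"
    by (rule lborel_pair.Fubini'[symmetric]) measurable
  also have "\<dots> = (\<integral>\<^sup>+r\<in>{0<..}. ennreal (p / (p - 1) * f r * \<Phi> r powr (p - 1)) \<partial>lborel)"
  proof (rule nn_integral_cong)
    fix r :: real
    show "(\<integral>\<^sup>+l. (if ?P r l then ?k l * ennreal (f r) else 0) \<partial>lborel)
        = ennreal (p / (p - 1) * f r * \<Phi> r powr (p - 1)) * indicator {0<..} r"
    proof (cases "0 < r")
      case True
      let ?g = "\<lambda>l. if 0 < l \<and> l < \<Phi> r then ennreal ((p - 1) * l powr (p - 1 - 1)) else 0"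
      have "p / (p - 1) * f r * ((p - 1) * w) = p * w * f r" for w
        using p by simp
      then have "(\<integral>\<^sup>+l. (if ?P r l then ?k l * ennreal (f r) else 0) \<partial>lborel)
          = (\<integral>\<^sup>+l. ennreal (p / (p - 1) * f r) * ?g l \<partial>lborel)"
        using True p nonneg[of r]
        by (intro nn_integral_cong) (auto simp flip: ennreal_mult)
      also have "\<dots> = ennreal (p / (p - 1) * f r) * ennreal (\<Phi> r powr (p - 1))"
        using p maximal_nonneg[of r] by (subst nn_integral_cmult) (auto simp: nn_integral_layer_powr)
      finally show ?thesis using True p nonneg[of r] by (simp flip: ennreal_mult)
    qed simp
  qed
  finally show ?thesis .
qed

text \<open>\<open>\<Phi>\<close> need not vanish beyond \<open>T\<close>, but
  \<open>maximal_powr_le\<close> trades one power of it for \<open>f\<close>, leaving a bounded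
  integrand that does.\<close>

lemma maximal_powr_finite:
  assumes p: "1 < p"
  shows "(\<integral>\<^sup>+r\<in>{0<..}. ennreal (\<Phi> r powr p) \<partial>lborel) < \<infinity>"
proof -
  note maximal_powr_le[OF p]
  also have "(\<integral>\<^sup>+r\<in>{0<..}. ennreal (p / (p - 1) * f r * \<Phi> r powr (p - 1)) \<partial>lborel)
      \<le> (\<integral>\<^sup>+r. ennreal (p / (p - 1) * B * B powr (p - 1)) * indicator {0..\<bar>T\<bar>} r \<partial>lborel)"
  proof (rule nn_integral_mono)
    fix r :: real
    show "ennreal (p / (p - 1) * f r * \<Phi> r powr (p - 1)) * indicator {0<..} r
      \<le> ennreal (p / (p - 1) * B * B powr (p - 1)) * indicator {0..\<bar>T\<bar>} r"
    proof (cases "0 < r \<and> r \<le> T")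
      case True
      have "p / (p - 1) * f r * \<Phi> r powr (p - 1) \<le> p / (p - 1) * B * B powr (p - 1)"
        using p nonneg le B_nonneg maximal_nonneg maximal_le
        by (intro mult_mono powr_mono2) auto
      then show ?thesis using True by (simp add: ennreal_leI)
    next
      case False
      then have "r \<le> 0 \<or> f r = 0" using support by auto
      then show ?thesis by auto
    qed
  qed
  also have "\<dots> < \<infinity>"
    by (subst nn_integral_cmult_indicator) (auto simp: ennreal_mult_less_top)
  finally show ?thesis .
qed

text \<open>Grouping \<open>q\<close> with \<open>f\<close> in Young's inequality gives
  \<open>?X \<le> q powr p / p * ?Y + 1 / q * ?X\<close>. As \<open>?X\<close> is finite,
  subtraction leaves \<open>?X / p\<close> on the left, and the factors \<open>1 / p\<close>
  cancel.\<close>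

lemma maximal_powr_strong:
  assumes p: "1 < p"
  shows "(\<integral>\<^sup>+r\<in>{0<..}. ennreal (\<Phi> r powr p) \<partial>lborel)
    \<le> ennreal ((p / (p - 1)) powr p) * (\<integral>\<^sup>+r\<in>{0<..}. ennreal (f r powr p) \<partial>lborel)" (is "?X \<le> _ * ?Y")
proof (cases "?Y = \<infinity>")
  case True
  have "ennreal ((p / (p - 1)) powr p) \<noteq> 0" using p by simp
  then show ?thesis unfolding True by (simp add: ennreal_mult_top)
next
  case False
  define q where "q = p / (p - 1)"
  have q: "q > 1" "1 / p + 1 / q = 1" using p by (auto simp: q_def field_simps)
  have young: "q * f r * \<Phi> r powr (p - 1) \<le> q powr p / p * f r powr p + 1 / q * \<Phi> r powr p" for r
  proof -
    have "(q * f r) * \<Phi> r powr (p - 1) \<le> (q * f r) powr p / p + (\<Phi> r powr (p - 1)) powr q / q"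
      using p q nonneg[of r] by (intro Youngs_inequality) auto
    also have "(\<Phi> r powr (p - 1)) powr q = \<Phi> r powr p"
      using p by (simp add: powr_powr q_def)
    finally show ?thesis using q nonneg[of r] by (simp add: powr_mult)
  qed
  have "?X \<le> (\<integral>\<^sup>+r\<in>{0<..}. ennreal (q * f r * \<Phi> r powr (p - 1)) \<partial>lborel)"
    using maximal_powr_le[OF p] by (simp add: q_def)
  also have "\<dots> \<le> (\<integral>\<^sup>+r. ennreal (q powr p / p) * (ennreal (f r powr p) * indicator {0<..} r)
      + ennreal (1 / q) * (ennreal (\<Phi> r powr p) * indicator {0<..} r) \<partial>lborel)"
  proof (rule nn_integral_mono)
    fix r :: real
    show "ennreal (q * f r * \<Phi> r powr (p - 1)) * indicator {0<..} r
      \<le> ennreal (q powr p / p) * (ennreal (f r powr p) * indicator {0<..} r)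
      + ennreal (1 / q) * (ennreal (\<Phi> r powr p) * indicator {0<..} r)"
      using ennreal_leI[OF young[of r]] p q
      by (auto simp: indicator_def ennreal_mult ennreal_plus simp flip: ennreal_mult)
  qed
  also have "\<dots> = ennreal (q powr p / p) * ?Y + ennreal (1 / q) * ?X"
    by (subst nn_integral_add) (auto simp: nn_integral_cmult)
  finally have ineq: "?X \<le> ennreal (q powr p / p) * ?Y + ennreal (1 / q) * ?X" .
  obtain x where x: "?X = ennreal x" "x \<ge> 0"
    using maximal_powr_finite[OF p] by (cases ?X) auto
  obtain y where y: "?Y = ennreal y" "y \<ge> 0" using False by (cases ?Y) auto
  have "ennreal x \<le> ennreal (q powr p / p * y + 1 / q * x)"
    using ineq x(2) y(2) p q unfolding x(1) y(1)
    by (subst ennreal_plus) (auto simp del: ennreal_plus simp flip: ennreal_mult)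
  then have "x \<le> q powr p / p * y + 1 / q * x"
    using x y p q by (subst (asm) ennreal_le_iff) auto
  moreover have "1 / q = 1 - 1 / p" using q by simp
  ultimately have "x \<le> q powr p * y"
    using p by (simp add: algebra_simps) (simp add: field_simps)
  then show ?thesis using x y q by (simp add: q_def ennreal_leI flip: ennreal_mult)
qed

end

text \<open>A proof by \<open>p\<close>-th roots. It serves where a supremum of truncated means
  exceeds every \<open>z < y\<close> although \<open>y\<close> itself may not be attained at any
  stage.\<close>

lemma powr_le_if_all_smaller:
  fixes y k p :: real
  assumes "p > 0" "y \<ge> 0" "k \<ge> 0" and less: "\<And>z. 0 \<le> z \<Longrightarrow> z < y \<Longrightarrow> z powr p \<le> k"
  shows "y powr p \<le> k"
proof -
  have "y \<le> k powr (1 / p)"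
  proof (rule dense_le)
    fix z assume "z < y"
    show "z \<le> k powr (1 / p)"
    proof (cases "z \<ge> 0")
      case True
      from less[OF True \<open>z < y\<close>] have "(z powr p) powr (1 / p) \<le> k powr (1 / p)"
        using assms by (intro powr_mono2) auto
      then show ?thesis using True assms(1) by (simp add: powr_powr)
    qed (simp add: order_trans[of z 0])
  qed
  then have "y powr p \<le> (k powr (1 / p)) powr p"
    using assms by (intro powr_mono2) auto
  then show ?thesis using assms by (simp add: powr_powr)
qed

text \<open>The condition on \<open>y\<close> compares it with the mean over \<open>(0, t)\<close>
  without dividing. When that integral is infinite, every \<open>y \<ge> 0\<close>
  qualifies.\<close>

theorem Hardy_maximal_inequality:
  fixes f :: "real \<Rightarrow> real"
  assumes p: "1 < p" and f[measurable]: "f \<in> borel_measurable borel" and nonneg: "\<And>x. 0 \<le> f x"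
  shows "(\<integral>\<^sup>+r\<in>{0<..}. (SUP y\<in>{y. 0 \<le> y \<and> (\<exists>t\<ge>r. ennreal (y * t) \<le> (\<integral>\<^sup>+x\<in>{0<..t}. ennreal (f x) \<partial>lborel))}.
            ennreal (y powr p)) \<partial>lborel)
    \<le> ennreal ((p / (p - 1)) powr p) * (\<integral>\<^sup>+r\<in>{0<..}. ennreal (f r powr p) \<partial>lborel)"
    (is "(\<integral>\<^sup>+r\<in>_. ?M r \<partial>_) \<le> ?C * ?Y")
proof -
  \<comment> \<open>Cutting height and support at \<open>n\<close> gives a bounded profile with
    \<open>B = T = n\<close>; on the positive half-line these profiles increase to
    \<open>f\<close>.\<close>
  define g where "g n x = min (f x) (real n) * indicator {0<..real n} x" for n :: nat and x
  interpret g: bounded_profile "g n" "real n" "real n" for n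
    by standard (use nonneg in \<open>auto simp: g_def[abs_def] indicator_def\<close>)
  let ?\<Phi> = "\<lambda>n. maximal_average (g n)"
  have g_mono: "g m x \<le> g n x" if "m \<le> n" for m n x
    using that nonneg[of x] by (auto simp: g_def indicator_def)
  have \<Phi>_mono: "?\<Phi> m r \<le> ?\<Phi> n r" if "m \<le> n" for m n r
    unfolding maximal_average_def
  proof (rule cSUP_mono[OF g.range_nonempty g.bdd_above_average])
    fix s assume s: "s \<in> {r..} \<inter> {0<..}"
    have "(\<integral>\<^sup>+x\<in>{0<..s}. ennreal (g m x) \<partial>lborel) \<le> (\<integral>\<^sup>+x\<in>{0<..s}. ennreal (g n x) \<partial>lborel)"
      by (intro nn_integral_mono mult_right_mono ennreal_leI g_mono[OF that]) simp
    moreover have "(\<integral>\<^sup>+x\<in>{0<..s}. ennreal (g n x) \<partial>lborel) < top"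
      using s by (simp add: g.nn_integral_initial(1))
    ultimately have "initial_average (g m) s \<le> initial_average (g n) s"
      using s unfolding initial_average_def by (intro divide_right_mono enn2real_mono) auto
    then show "\<exists>t\<in>{r..} \<inter> {0<..}. initial_average (g m) s \<le> initial_average (g n) t"
      using s by blast
  qed
  define K where "K r = (SUP n. ennreal (?\<Phi> n r powr p))" for r
  have "?M r \<le> K r" if r: "r > 0" for r
  proof (rule SUP_least, clarify)
    fix y t assume y: "0 \<le> y" and t: "r \<le> t" "ennreal (y * t) \<le> (\<integral>\<^sup>+x\<in>{0<..t}. ennreal (f x) \<partial>lborel)"
    have "t > 0" using r t by simp
    show "ennreal (y powr p) \<le> K r"
    proof (cases "K r = \<infinity>")
      case False
      then obtain k where k: "K r = ennreal k" "k \<ge> 0" by (cases "K r") auto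
      have "(\<integral>\<^sup>+x\<in>{0<..t}. ennreal (f x) \<partial>lborel) = (\<integral>\<^sup>+x. (SUP n. ennreal (g n x) * indicator {0<..t} x) \<partial>lborel)"
      proof (rule nn_integral_cong)
        fix x
        show "ennreal (f x) * indicator {0<..t} x = (SUP n. ennreal (g n x) * indicator {0<..t} x)"
        proof (cases "0 < x")
          case True
          obtain n where n: "real n \<ge> max (f x) x" using real_arch_simple by blast
          show ?thesis
          proof (rule antisym)
            have "ennreal (f x) = ennreal (g n x)" using True n by (simp add: g_def)
            then show "ennreal (f x) * indicator {0<..t} x \<le> (SUP n. ennreal (g n x) * indicator {0<..t} x)"
              by (metis (mono_tags, lifting) SUP_upper UNIV_I)
            show "(SUP n. ennreal (g n x) * indicator {0<..t} x) \<le> ennreal (f x) * indicator {0<..t} x"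
              by (intro SUP_least mult_right_mono ennreal_leI) (use nonneg[of x] in \<open>auto simp: g_def indicator_def\<close>)
          qed
        qed simp
      qed
      also have "\<dots> = (SUP n. \<integral>\<^sup>+x. ennreal (g n x) * indicator {0<..t} x \<partial>lborel)"
        by (rule nn_integral_monotone_convergence_SUP)
           (auto intro!: incseq_SucI le_funI mult_right_mono ennreal_leI g_mono)
      also have "\<dots> = (SUP n. ennreal (t * initial_average (g n) t))"
        using g.nn_integral_initial(1)[OF \<open>t > 0\<close>] by simp
      finally have sup: "ennreal (y * t) \<le> (SUP n. ennreal (t * initial_average (g n) t))"
        using t(2) by simp
      have "y powr p \<le> k"
      proof (rule powr_le_if_all_smaller)
        fix z assume z: "0 \<le> z" "z < y"
        have "ennreal (z * t) < ennreal (y * t)"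
          using z \<open>t > 0\<close> by (intro ennreal_lessI) auto
        also note sup
        finally obtain n where "ennreal (z * t) < ennreal (t * initial_average (g n) t)"
          unfolding less_SUP_iff by blast
        then have "z < initial_average (g n) t"
          using z \<open>t > 0\<close> by (subst (asm) ennreal_less_iff) (auto simp: mult.commute)
        also have "\<dots> \<le> ?\<Phi> n r" using t(1) \<open>t > 0\<close> by (rule g.average_le_maximal)
        finally have "z powr p \<le> ?\<Phi> n r powr p" using z p by (intro powr_mono2) auto
        then have "ennreal (z powr p) \<le> ennreal (?\<Phi> n r powr p)" by (rule ennreal_leI)
        also have "\<dots> \<le> ennreal k" unfolding k(1)[symmetric] K_def by (rule SUP_upper) simp
        finally show "z powr p \<le> k" using k(2) by simp
      qed (use p y k in auto)
      then show ?thesis using k by (simp add: ennreal_leI)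
    qed simp
  qed
  then have "(\<integral>\<^sup>+r\<in>{0<..}. ?M r \<partial>lborel) \<le> (\<integral>\<^sup>+r. (SUP n. ennreal (?\<Phi> n r powr p) * indicator {0<..} r) \<partial>lborel)"
    by (intro nn_integral_mono) (auto simp: K_def indicator_def)
  also have "\<dots> = (SUP n. \<integral>\<^sup>+r\<in>{0<..}. ennreal (?\<Phi> n r powr p) \<partial>lborel)"
  proof (rule nn_integral_monotone_convergence_SUP)
    show "incseq (\<lambda>n r. ennreal (?\<Phi> n r powr p) * indicator {0<..} r)"
      using p g.maximal_nonneg \<Phi>_mono
      by (intro incseq_SucI le_funI mult_right_mono ennreal_leI powr_mono2) auto
  qed measurable
  also have "\<dots> \<le> ?C * ?Y"
  proof (rule SUP_least)
    fix n
    have "(\<integral>\<^sup>+r\<in>{0<..}. ennreal (?\<Phi> n r powr p) \<partial>lborel) \<le> ?C * (\<integral>\<^sup>+r\<in>{0<..}. ennreal (g n r powr p) \<partial>lborel)"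
      by (rule g.maximal_powr_strong[OF p])
    also have "\<dots> \<le> ?C * ?Y"
      by (intro mult_left_mono nn_integral_mono mult_right_mono ennreal_leI powr_mono2)
         (use p nonneg g.nonneg in \<open>auto simp: g_def indicator_def\<close>)
    finally show "(\<integral>\<^sup>+r\<in>{0<..}. ennreal (?\<Phi> n r powr p) \<partial>lborel) \<le> ?C * ?Y" .
  qed
  finally show ?thesis .
qed

section \<open>Improved Hardy inequality\<close>

lemma abs_le_nn_integral_deriv:
  assumes u: "loc_abs_cont_pos u"
    and liminf: "Liminf (at_right 0) (\<lambda>r. ereal \<bar>u r\<bar>) = 0"
    and "s > 0"
  shows "ennreal \<bar>u s\<bar> \<le> (\<integral>\<^sup>+x\<in>{0<..s}. ennreal \<bar>deriv u x\<bar> \<partial>lebesgue)" (is "_ \<le> ?I")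
proof (rule ennreal_le_epsilon)
  fix e :: real assume "e > 0"
  \<comment> \<open>A vanishing lower limit makes \<open>\<bar>u\<bar>\<close> small only at some
    points near \<open>0\<close>, but a single starting point \<open>a\<close> for each
    \<open>e\<close> suffices.\<close>
  have "\<exists>a. 0 < a \<and> a < s \<and> \<bar>u a\<bar> < e"
  proof (rule ccontr)
    assume "\<not> ?thesis"
    then have "\<forall>\<^sub>F a in at_right 0. ereal e \<le> ereal \<bar>u a\<bar>"
      using \<open>s > 0\<close> unfolding eventually_at_right_field by (intro exI[of _ s]) (force simp: not_less)
    from Liminf_bounded[OF this] show False using liminf \<open>e > 0\<close> by simp
  qed
  then obtain a where a: "0 < a" "a < s" "\<bar>u a\<bar> < e" by blast
  have "ennreal \<bar>u s\<bar> \<le> ennreal (\<bar>u s - u a\<bar> + e)"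
    using a by (intro ennreal_leI) auto
  also have "\<dots> = ennreal \<bar>u s - u a\<bar> + ennreal e"
    using \<open>e > 0\<close> by simp
  also have "ennreal \<bar>u s - u a\<bar> \<le> (\<integral>\<^sup>+x\<in>{a..s}. ennreal \<bar>deriv u x\<bar> \<partial>lebesgue)"
    using a by (intro loc_abs_cont_pos_increment_le[OF u]) auto
  also have "\<dots> \<le> ?I"
    using a by (intro nn_integral_mono mult_left_mono) (auto simp: indicator_def)
  finally show "ennreal \<bar>u s\<bar> \<le> ?I + ennreal e" by (simp add: add_right_mono)
qed

theorem theorem1p1:
  fixes p :: real and u :: "real \<Rightarrow> real"
  assumes "1 < p"
    and "loc_abs_cont_pos u"
    and "Liminf (at_right 0) (\<lambda>r. ereal \<bar>u r\<bar>) = 0"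
  shows "(\<integral>\<^sup>+ r\<in>{0<..}. max (SUP s\<in>{0<..r}. ennreal (\<bar>u s\<bar> powr p / r powr p))
                               (SUP s\<in>{r..}. ennreal (\<bar>u s\<bar> powr p / s powr p)) \<partial>lebesgue)
         \<le> ennreal ((p / (p - 1)) powr p) * (\<integral>\<^sup>+ r\<in>{0<..}. ennreal (\<bar>deriv u r\<bar> powr p) \<partial>lebesgue)"
proof -
  \<comment> \<open>The maximal inequality is set over Borel functions and \<open>lborel\<close>, so
    the Lebesgue measurable \<open>deriv u\<close> is replaced by a Borel function equal to it
    almost everywhere on the half-line.\<close>
  obtain g where g: "g \<in> borel_measurable lborel" "AE x in lborel. indicator {0<..} x * deriv u x = g x"
    using completion_ex_borel_measurable_real[OF loc_abs_cont_pos_deriv_measurable[OF assms(2)]] by blast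
  define f where "f x = \<bar>g x\<bar>" for x
  have f[measurable]: "f \<in> borel_measurable borel" "\<And>x. 0 \<le> f x"
    using g(1) by (auto simp: f_def[abs_def])
  have f_eq: "AE x in lborel. 0 < x \<longrightarrow> \<bar>deriv u x\<bar> = f x"
    using g(2) by eventually_elim (auto simp: f_def indicator_def)
  let ?F = "\<lambda>t. \<integral>\<^sup>+x\<in>{0<..t}. ennreal (f x) \<partial>lborel"
  have u_le: "ennreal \<bar>u s\<bar> \<le> ?F t" if "0 < s" "s \<le> t" for s t
  proof -
    have "ennreal \<bar>u s\<bar> \<le> (\<integral>\<^sup>+x\<in>{0<..s}. ennreal \<bar>deriv u x\<bar> \<partial>lebesgue)"
      using assms(2,3) that(1) by (rule abs_le_nn_integral_deriv)
    also have "\<dots> = (\<integral>\<^sup>+x\<in>{0<..s}. ennreal (f x) \<partial>lborel)"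
      unfolding nn_integral_completion
      by (rule nn_integral_cong_AE) (use f_eq in eventually_elim, auto simp: indicator_def)
    also have "\<dots> \<le> ?F t"
      using that by (intro nn_integral_mono mult_left_mono) (auto simp: indicator_def)
    finally show ?thesis .
  qed
  let ?M = "\<lambda>r. SUP y\<in>{y. 0 \<le> y \<and> (\<exists>t\<ge>r. ennreal (y * t) \<le> ?F t)}. ennreal (y powr p)"
  \<comment> \<open>One estimate serves both suprema: \<open>t = r\<close> for
    \<open>s \<le> r\<close>, and \<open>t = s\<close> for \<open>s \<ge> r\<close>.\<close>
  have quot: "ennreal (\<bar>u s\<bar> powr p / t powr p) \<le> ?M r" if "0 < s" "s \<le> t" "0 < r" "r \<le> t" for r s t
  proof -
    have "t > 0" using that by simp
    then have "ennreal (\<bar>u s\<bar> / t * t) \<le> ?F t" using u_le[OF that(1,2)] by simp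
    then have "\<bar>u s\<bar> / t \<in> {y. 0 \<le> y \<and> (\<exists>t\<ge>r. ennreal (y * t) \<le> ?F t)}"
      using that(4) \<open>t > 0\<close> by auto
    then have "ennreal ((\<bar>u s\<bar> / t) powr p) \<le> ?M r" by (rule SUP_upper)
    then show ?thesis using \<open>t > 0\<close> by (simp add: powr_divide)
  qed
  have "(\<integral>\<^sup>+ r\<in>{0<..}. max (SUP s\<in>{0<..r}. ennreal (\<bar>u s\<bar> powr p / r powr p))
            (SUP s\<in>{r..}. ennreal (\<bar>u s\<bar> powr p / s powr p)) \<partial>lebesgue)
      \<le> (\<integral>\<^sup>+r\<in>{0<..}. ?M r \<partial>lborel)"
    \<comment> \<open>\<open>nn_integral\<close> is monotone on arbitrary functions, so the
      uncountable suprema can be compared pointwise.\<close>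
    unfolding nn_integral_completion
  proof (rule nn_integral_mono)
    fix r :: real
    have "max (SUP s\<in>{0<..r}. ennreal (\<bar>u s\<bar> powr p / r powr p))
        (SUP s\<in>{r..}. ennreal (\<bar>u s\<bar> powr p / s powr p)) \<le> ?M r" if "0 < r"
      using that by (intro max.boundedI SUP_least quot) auto
    then show "max (SUP s\<in>{0<..r}. ennreal (\<bar>u s\<bar> powr p / r powr p))
        (SUP s\<in>{r..}. ennreal (\<bar>u s\<bar> powr p / s powr p)) * indicator {0<..} r \<le> ?M r * indicator {0<..} r"
      by (cases "0 < r") auto
  qed
  also have "\<dots> \<le> ennreal ((p / (p - 1)) powr p) * (\<integral>\<^sup>+r\<in>{0<..}. ennreal (f r powr p) \<partial>lborel)"
    by (rule Hardy_maximal_inequality[OF assms(1) f])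
  also have "(\<integral>\<^sup>+r\<in>{0<..}. ennreal (f r powr p) \<partial>lborel)
      = (\<integral>\<^sup>+ r\<in>{0<..}. ennreal (\<bar>deriv u r\<bar> powr p) \<partial>lebesgue)"
    unfolding nn_integral_completion
    by (rule nn_integral_cong_AE) (use f_eq in eventually_elim, auto simp: indicator_def)
  finally show ?thesis .
qed

end
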